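(* Let $\mathbb V=H^1(\mathcal D)$ and $\mathbb V_T=H^1(\mathcal D)\cap L^\infty(\mathcal D)$, and let $$\mathcal J(u,v)=\int_{\mathcal D}\Big[\frac{|T|^2}{2(1+\beta^\alpha|T|^{2\alpha})^{1/\alpha}}+\rho|\nabla v|^2+\delta(1-v)\Big]dx,\qquad T=\sqrt{(1-\kappa)v^2+\kappa}\;\nabla u .$$ Then $\mathcal J$ is Fréchet-differentiable at every $(u,v)\in\mathbb V\times\mathbb V_T$, as a functional on $\mathbb V\times\mathbb V_T$ with increments $(\psi,\varphi)\in\mathbb V\times\mathbb V_T$ measured by $\|\psi\|_{H^1(\mathcal D)}+\|\varphi\|_{H^1(\mathcal D)}+\|\varphi\|_{L^\infty(\mathcal D)}$.
   Context: $\mathcal D\subset\mathbb R^d$, $d\in\{2,3\}$, is a smooth, open, connected, bounded domain. The parameters $\alpha>0$, $\beta\ge0$, $0<\kappa\ll1$, $\rho>0$, $\delta>0$ are fixed constants. *)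

theory Defs
  imports "HOL-Analysis.Analysis" "HOL-Probability.Essential_Supremum"
begin

definition partial_deriv :: "'n \<Rightarrow> (real^'n \<Rightarrow> real) \<Rightarrow> real^'n \<Rightarrow> real" where
  "partial_deriv i f x = frechet_derivative f (at x) (axis i 1)"

primrec Ck :: "nat \<Rightarrow> (real^'n \<Rightarrow> real) \<Rightarrow> bool" where
  "Ck 0 f \<longleftrightarrow> continuous_on UNIV f"
| "Ck (Suc k) f \<longleftrightarrow> f differentiable_on UNIV \<and> (\<forall>i. Ck k (partial_deriv i f))"

definition smooth :: "(real^'n \<Rightarrow> real) \<Rightarrow> bool" where
  "smooth f \<longleftrightarrow> (\<forall>k. Ck k f)"

text \<open>Near every boundary point, after relabelling and reorienting the coordinate axes
  (choice of \<open>i\<close> and \<open>s\<close>), the set is the strict epigraph of a smooth function of the remaining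
  coordinates. A function of the remaining coordinates is encoded as a function \<open>\<gamma>\<close> on the whole
  space that does not depend on the \<open>i\<close>-th coordinate.\<close>

definition smooth_boundary :: "(real^'n) set \<Rightarrow> bool" where
  "smooth_boundary D \<longleftrightarrow>
     (\<forall>p\<in>frontier D. \<exists>r>0. \<exists>i. \<exists>s\<in>{-1, 1}. \<exists>\<gamma>. smooth \<gamma> \<and>
        (\<forall>x t. \<gamma> (x + t *\<^sub>R axis i 1) = \<gamma> x) \<and>
        D \<inter> ball p r = {x \<in> ball p r. s * x $ i > \<gamma> x})"

definition smooth_bounded_domain :: "(real^'n) set \<Rightarrow> bool" where
  "smooth_bounded_domain D \<longleftrightarrow>
     open D \<and> D \<noteq> {} \<and> connected D \<and> bounded D \<and> smooth_boundary D"

text \<open>Elements of the function spaces below are represented by functions on the whole space, of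
  which only the values on \<open>D\<close> up to null sets matter. The spaces are therefore sets of
  representatives, on which the norms are seminorms whose kernel consists of the functions that
  vanish almost everywhere on \<open>D\<close>.\<close>

definition L2 :: "(real^'n) set \<Rightarrow> (real^'n \<Rightarrow> 'b::euclidean_space) set" where
  "L2 D = {f. f \<in> borel_measurable (lebesgue_on D) \<and>
              integrable (lebesgue_on D) (\<lambda>x. (norm (f x))\<^sup>2)}"

definition Linf :: "(real^'n) set \<Rightarrow> (real^'n \<Rightarrow> real) set" where
  "Linf D = {f. f \<in> borel_measurable (lebesgue_on D) \<and>
                esssup (lebesgue_on D) (\<lambda>x. ereal \<bar>f x\<bar>) < \<infinity>}"

definition Linf_norm :: "(real^'n) set \<Rightarrow> (real^'n \<Rightarrow> real) \<Rightarrow> real" where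
  "Linf_norm D f = real_of_ereal (esssup (lebesgue_on D) (\<lambda>x. ereal \<bar>f x\<bar>))"

definition test_functions :: "(real^'n) set \<Rightarrow> (real^'n \<Rightarrow> real) set" where
  "test_functions D = {\<phi>. smooth \<phi> \<and> (\<exists>K. compact K \<and> K \<subseteq> D \<and> (\<forall>x. x \<notin> K \<longrightarrow> \<phi> x = 0))}"

definition has_weak_gradient ::
    "(real^'n) set \<Rightarrow> (real^'n \<Rightarrow> real) \<Rightarrow> (real^'n \<Rightarrow> real^'n) \<Rightarrow> bool" where
  "has_weak_gradient D u g \<longleftrightarrow>
     (\<forall>\<phi>\<in>test_functions D. \<forall>i.
        (LINT x|lebesgue_on D. u x * partial_deriv i \<phi> x) =
        - (LINT x|lebesgue_on D. g x $ i * \<phi> x))"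

definition H1 :: "(real^'n) set \<Rightarrow> (real^'n \<Rightarrow> real) set" where
  "H1 D = {u. u \<in> L2 D \<and> (\<exists>g\<in>L2 D. has_weak_gradient D u g)}"

text \<open>The weak gradient of an \<open>H1\<close> function is unique up to null sets; the choice operator picks
  a representative.\<close>

definition weak_grad :: "(real^'n) set \<Rightarrow> (real^'n \<Rightarrow> real) \<Rightarrow> real^'n \<Rightarrow> real^'n" where
  "weak_grad D u = (SOME g. g \<in> L2 D \<and> has_weak_gradient D u g)"

definition H1_norm :: "(real^'n) set \<Rightarrow> (real^'n \<Rightarrow> real) \<Rightarrow> real" where
  "H1_norm D u = sqrt ((LINT x|lebesgue_on D. (u x)\<^sup>2) +
                       (LINT x|lebesgue_on D. (norm (weak_grad D u x))\<^sup>2))"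

text \<open>Frechet differentiability at \<open>(u, v)\<close> of a functional \<open>J\<close> on the product of two vector
  spaces \<open>V\<close>, \<open>W\<close> of real functions (pointwise operations), with respect to a seminorm \<open>N\<close> on
  \<open>V \<times> W\<close>; \<open>has_derivative\<close> does not apply as it needs normed types rather than carrier sets.
  The bounds also cover increments with \<open>N \<psi> \<phi> = 0\<close>: they force \<open>L\<close> to vanish on such increments
  and \<open>J\<close> not to change under them, so neither depends on the choice of representatives.\<close>

definition frechet_differentiable_at ::
    "('a \<Rightarrow> real) set \<Rightarrow> ('a \<Rightarrow> real) set \<Rightarrow> (('a \<Rightarrow> real) \<Rightarrow> ('a \<Rightarrow> real) \<Rightarrow> real) \<Rightarrow>
     (('a \<Rightarrow> real) \<Rightarrow> ('a \<Rightarrow> real) \<Rightarrow> real) \<Rightarrow> ('a \<Rightarrow> real) \<Rightarrow> ('a \<Rightarrow> real) \<Rightarrow> bool" where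
  "frechet_differentiable_at V W N J u v \<longleftrightarrow>
     (\<exists>L.
        (\<forall>\<psi>\<in>V. \<forall>\<phi>\<in>W. \<forall>\<psi>'\<in>V. \<forall>\<phi>'\<in>W. \<forall>a b.
           L (\<lambda>x. a * \<psi> x + b * \<psi>' x) (\<lambda>x. a * \<phi> x + b * \<phi>' x) = a * L \<psi> \<phi> + b * L \<psi>' \<phi>') \<and>
        (\<exists>C. \<forall>\<psi>\<in>V. \<forall>\<phi>\<in>W. \<bar>L \<psi> \<phi>\<bar> \<le> C * N \<psi> \<phi>) \<and>
        (\<forall>\<epsilon>>0. \<exists>\<eta>>0. \<forall>\<psi>\<in>V. \<forall>\<phi>\<in>W. N \<psi> \<phi> < \<eta> \<longrightarrow>
           \<bar>J (\<lambda>x. u x + \<psi> x) (\<lambda>x. v x + \<phi> x) - J u v - L \<psi> \<phi>\<bar> \<le> \<epsilon> * N \<psi> \<phi>))"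

definition energy ::
    "real \<Rightarrow> real \<Rightarrow> real \<Rightarrow> real \<Rightarrow> real \<Rightarrow> (real^'n) set \<Rightarrow>
     (real^'n \<Rightarrow> real) \<Rightarrow> (real^'n \<Rightarrow> real) \<Rightarrow> real" where
  "energy \<alpha> \<beta> \<kappa> \<rho> \<delta> D u v =
     (LINT x|lebesgue_on D.
        (let T = sqrt ((1 - \<kappa>) * (v x)\<^sup>2 + \<kappa>) *\<^sub>R weak_grad D u x
         in (norm T)\<^sup>2 / (2 * (1 + \<beta> powr \<alpha> * norm T powr (2 * \<alpha>)) powr (1 / \<alpha>))
            + \<rho> * (norm (weak_grad D v x))\<^sup>2 + \<delta> * (1 - v x)))"

end

theory Submission
  imports Defs
begin

text \<open>The elastic part of the energy density is \<open>\<Phi>(\<bar>T\<bar>\<^sup>2)\<close> with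
  \<open>\<Phi>(s) = s / (2 (1 + b s\<^sup>\<alpha>)\<^bsup>1/\<alpha>\<^esup>)\<close> and \<open>b = \<beta>\<^sup>\<alpha>\<close>. Its derivative simplifies to
  \<open>2 \<Phi>'(s) = (1 + b s\<^sup>\<alpha>)\<^bsup>-1/\<alpha>-1\<^esup> \<in> [0, 1]\<close>, and \<open>T \<mapsto> \<Phi>(\<bar>T\<bar>\<^sup>2)\<close> has, for every \<open>\<alpha> > 0\<close>, a
  first-order remainder of at most \<open>(1 + \<alpha>) \<bar>h\<bar>\<^sup>2\<close>, even where it is not twice differentiable.
  The degradation factor \<open>sqrt ((1 - \<kappa>) v\<^sup>2 + \<kappa>)\<close> also has a quadratic first-order remainder, as it
  stays above \<open>sqrt \<kappa>\<close>. For \<open>\<phi>\<close> bounded, the increment of \<open>T\<close> is therefore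
  controlled in \<open>L\<^sup>2\<close> and the remainder of the whole functional is of order
  \<open>\<parallel>\<phi>\<parallel>\<^sub>\<infinity>\<^sup>2 \<parallel>\<nabla>u\<parallel>\<^sup>2 + \<parallel>\<nabla>\<psi>\<parallel>\<^sup>2 + \<parallel>\<nabla>\<phi>\<parallel>\<^sup>2\<close>. That the weak gradient is linear up to null sets
  rests on its uniqueness, which follows by testing against smooth bumps that increase to the
  indicator of a box.\<close>

section \<open>Smooth bumps on boxes\<close>

lemma partial_deriv_eq:
  "(f has_derivative f') (at x) \<Longrightarrow> partial_deriv i f x = f' (axis i 1)"
  unfolding partial_deriv_def by (metis frechet_derivative_at)

lemma has_derivative_frechet:
  "f differentiable_on UNIV \<Longrightarrow> (f has_derivative frechet_derivative f (at x)) (at x)"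
  by (simp add: differentiable_on_def frechet_derivative_works[symmetric])

text \<open>The product rule pairs an undifferentiated factor with a derivative of one order less,
  so the induction in \<open>Ck_mult\<close> has to lower the order of the former.\<close>

lemma Ck_Suc_imp_Ck: "Ck (Suc k) f \<Longrightarrow> Ck k f"
proof (induction k arbitrary: f)
  case 0
  then show ?case by (simp add: differentiable_imp_continuous_on)
next
  case (Suc k)
  then show ?case by (metis Ck.simps(2))
qed

lemma Ck_const: "Ck k (\<lambda>x. c)"
proof (induction k arbitrary: c)
  case (Suc k)
  have "partial_deriv i (\<lambda>x. c) = (\<lambda>x. 0)" for i :: 'a
    by (rule ext, subst partial_deriv_eq[OF has_derivative_const]) simp
  with Suc show ?case by simp
qed simp

lemma Ck_add: "Ck k f \<Longrightarrow> Ck k g \<Longrightarrow> Ck k (\<lambda>x. f x + g x)"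
proof (induction k arbitrary: f g)
  case 0
  then show ?case by (simp add: continuous_on_add)
next
  case (Suc k)
  then have fg: "f differentiable_on UNIV" "g differentiable_on UNIV" by auto
  have "partial_deriv i (\<lambda>x. f x + g x) = (\<lambda>x. partial_deriv i f x + partial_deriv i g x)" for i
    by (rule ext, subst partial_deriv_eq[OF has_derivative_add[OF fg[THEN has_derivative_frechet]]])
       (simp add: partial_deriv_def)
  with Suc fg show ?case by (auto intro: differentiable_on_add)
qed

lemma Ck_mult: "Ck k f \<Longrightarrow> Ck k g \<Longrightarrow> Ck k (\<lambda>x. f x * g x)"
proof (induction k arbitrary: f g)
  case 0
  then show ?case by (simp add: continuous_on_mult)
next
  case (Suc k)
  then have fg: "f differentiable_on UNIV" "g differentiable_on UNIV" by auto
  have "partial_deriv i (\<lambda>x. f x * g x) =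
      (\<lambda>x. f x * partial_deriv i g x + partial_deriv i f x * g x)" for i
    by (rule ext, subst partial_deriv_eq[OF has_derivative_mult[OF fg[THEN has_derivative_frechet]]])
       (simp add: partial_deriv_def)
  moreover have "Ck k (\<lambda>x. f x * partial_deriv i g x + partial_deriv i f x * g x)" for i
    using Suc Ck_Suc_imp_Ck[OF Suc.prems(1)] Ck_Suc_imp_Ck[OF Suc.prems(2)]
    by (intro Ck_add Suc.IH) auto
  ultimately show ?case using fg by (auto intro: differentiable_on_mult)
qed

lemma Ck_prod:
  assumes "finite I" "\<And>i. i \<in> I \<Longrightarrow> Ck k (f i)"
  shows "Ck k (\<lambda>x. \<Prod>i\<in>I. f i x)"
  using assms by (induction rule: finite_induct) (auto intro: Ck_const Ck_mult)

text \<open>These functions are closed under differentiation for fixed \<open>c > 0\<close>, so their smoothness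
  follows by induction with \<open>p\<close> arbitrary.\<close>

definition exp_inv :: "real \<Rightarrow> real poly \<Rightarrow> real \<Rightarrow> real" where
  "exp_inv c p t = (if t > 0 then poly p (1 / t) * exp (- c / t) else 0)"

text \<open>Exponential decay beats polynomial growth, monomial by monomial. With
  \<open>y = 1 / t\<close> this makes \<open>exp_inv\<close> flat at the origin.\<close>

lemma poly_mult_exp_tendsto_0:
  fixes p :: "real poly"
  assumes "c > 0"
  shows "((\<lambda>y. poly p y * exp (- c * y)) \<longlongrightarrow> 0) at_top"
proof -
  have pow: "((\<lambda>y. y ^ k * exp (- c * y)) \<longlongrightarrow> 0) at_top" for k
  proof -
    \<comment> \<open>Rescaling \<open>y\<close> to \<open>c * y\<close> reduces the claim to rate
      one, at the price of the factor \<open>1 / c ^ k\<close>.\<close>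
    have "filterlim (\<lambda>y. c * y) at_top at_top"
      using assms by (simp add: filterlim_tendsto_pos_mult_at_top[OF tendsto_const _ filterlim_ident])
    from filterlim_compose[OF tendsto_power_div_exp_0 this, of k]
    have "((\<lambda>y. (1 / c ^ k) * ((c * y) ^ k / exp (c * y))) \<longlongrightarrow> (1 / c ^ k) * 0) at_top"
      by (intro tendsto_mult tendsto_const)
    moreover have "(1 / c ^ k) * ((c * y) ^ k / exp (c * y)) = y ^ k * exp (- c * y)" for y
      using assms by (simp add: power_mult_distrib exp_minus field_simps)
    ultimately show ?thesis by simp
  qed
  have "((\<lambda>y. \<Sum>k\<le>degree p. coeff p k * (y ^ k * exp (- c * y))) \<longlongrightarrow>
      (\<Sum>k\<le>degree p. coeff p k * 0)) at_top"
    by (intro tendsto_sum tendsto_mult tendsto_const pow)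
  then show ?thesis
    by (simp add: poly_altdef sum_distrib_right mult.assoc)
qed

text \<open>For \<open>t > 0\<close> the chain rule yields a factor \<open>1 / t\<^sup>2\<close>,
  which is the polynomial \<open>[:0, 0, 1:]\<close> at \<open>1 / t\<close>, so the derivative
  keeps the form \<open>exp_inv c q\<close>. At the origin both one-sided difference quotients tend
  to 0.\<close>

lemma exp_inv_has_real_derivative:
  assumes "c > 0"
  shows "(exp_inv c p has_real_derivative
          exp_inv c ([:0, 0, 1:] * (smult c p - pderiv p)) t) (at t)"
proof -
  consider "t > 0" | "t < 0" | "t = 0" by linarith
  then show ?thesis
  proof cases
    case 1
    have "((\<lambda>t. poly p (1 / t) * exp (- c / t)) has_real_derivative
        exp_inv c ([:0, 0, 1:] * (smult c p - pderiv p)) t) (at t)"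
      using 1 by (auto intro!: derivative_eq_intros DERIV_chain'[OF _ poly_DERIV]
          simp: exp_inv_def field_simps power2_eq_square)
    then show ?thesis
      by (rule DERIV_cong_ev[THEN iffD1, OF refl _ refl, rotated])
         (use eventually_nhds_in_open[of "{0<..}" t] 1 in
           \<open>auto simp: exp_inv_def elim: eventually_mono\<close>)
  next
    case 2
    have "((\<lambda>t. 0) has_real_derivative
        exp_inv c ([:0, 0, 1:] * (smult c p - pderiv p)) t) (at t)"
      using 2 by (simp add: exp_inv_def)
    then show ?thesis
      by (rule DERIV_cong_ev[THEN iffD1, OF refl _ refl, rotated])
         (use eventually_nhds_in_open[of "{..<0}" t] 2 in
           \<open>auto simp: exp_inv_def elim: eventually_mono\<close>)
  next
    case 3
    \<comment> \<open>With \<open>y = 1 / h\<close> the right difference quotient at 0 is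
      \<open>y * poly p y * exp (- c * y)\<close>; the extra factor \<open>y\<close> accounts for
      \<open>pCons 0 p\<close>.\<close>
    have "((\<lambda>y. poly (pCons 0 p) y * exp (- c * y)) \<longlongrightarrow> 0) at_top"
      by (rule poly_mult_exp_tendsto_0[OF assms])
    from filterlim_compose[OF this filterlim_inverse_at_top_right]
    have "((\<lambda>h. poly (pCons 0 p) (inverse h) * exp (- c * inverse h)) \<longlongrightarrow> 0) (at_right 0)" .
    then have "((\<lambda>h. exp_inv c p h / h) \<longlongrightarrow> 0) (at_right 0)"
      by (rule Lim_transform_eventually)
         (auto simp: eventually_at_filter exp_inv_def field_simps)
    moreover have "((\<lambda>h. exp_inv c p h / h) \<longlongrightarrow> 0) (at_left 0)"
      by (rule Lim_transform_eventually[OF tendsto_const])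
         (auto simp: eventually_at_filter exp_inv_def)
    ultimately have "((\<lambda>h. exp_inv c p h / h) \<longlongrightarrow> 0) (at 0)"
      by (simp add: filterlim_split_at)
    then show ?thesis
      using 3 by (simp add: DERIV_def exp_inv_def)
  qed
qed

text \<open>The affine argument covers the two faces of a box orthogonal to axis \<open>i\<close>,
  with \<open>s = 1\<close> and \<open>s = -1\<close>. Each partial derivative is a constant times a
  function of the same kind with another polynomial.\<close>

lemma Ck_exp_inv_coordinate:
  assumes "c > 0"
  shows "Ck k (\<lambda>x::real^'n. exp_inv c p (s * x $ i + d))"
proof (induction k arbitrary: p)
  case 0
  have "continuous_on UNIV (exp_inv c p)"
    using exp_inv_has_real_derivative[OF assms] DERIV_isCont continuous_at_imp_continuous_on
    by blast
  then show ?case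
    by (auto intro!: continuous_on_compose2[of UNIV "exp_inv c p"] continuous_intros)
next
  case (Suc k)
  let ?q = "[:0, 0, 1:] * (smult c p - pderiv p)"
  have der: "((\<lambda>x::real^'n. exp_inv c p (s * x $ i + d)) has_derivative
      (\<lambda>h. (s * h $ i) * exp_inv c ?q (s * x $ i + d))) (at x)" for x
  proof -
    have "((\<lambda>x::real^'n. s * x $ i + d) has_derivative (\<lambda>h. s * h $ i)) (at x)"
      by (auto intro!: derivative_eq_intros bounded_linear_imp_has_derivative bounded_linear_vec_nth)
    from has_derivative_compose[OF this
        exp_inv_has_real_derivative[OF assms, unfolded has_field_derivative_def]]
    show ?thesis by (simp add: mult.commute)
  qed
  have "partial_deriv j (\<lambda>x::real^'n. exp_inv c p (s * x $ i + d)) =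
      (\<lambda>x. (s * axis j 1 $ i) * exp_inv c ?q (s * x $ i + d))" for j
    by (rule ext) (rule partial_deriv_eq[OF der])
  moreover have "(\<lambda>x::real^'n. exp_inv c p (s * x $ i + d)) differentiable_on UNIV"
    using der by (auto simp: differentiable_on_def differentiable_def intro: has_derivative_at_withinI)
  ultimately show ?case
    using Suc by (auto intro!: Ck_mult Ck_const)
qed

text \<open>Each factor is \<open>exp (- 1 / (Suc m * t))\<close>, where \<open>t\<close> is the
  signed distance to a face: it vanishes for \<open>t \<le> 0\<close>, and for \<open>t > 0\<close>
  it increases to 1 with \<open>m\<close>. \<open>Suc\<close> keeps the rate positive.\<close>

definition box_bump :: "nat \<Rightarrow> real^'n \<Rightarrow> real^'n \<Rightarrow> real^'n \<Rightarrow> real" where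
  "box_bump m a b x = (\<Prod>i\<in>UNIV. exp_inv (1 / Suc m) 1 (1 * x $ i + (- a $ i)) *
                                  exp_inv (1 / Suc m) 1 ((-1) * x $ i + b $ i))"

lemma smooth_box_bump: "smooth (box_bump m a b)"
  unfolding smooth_def box_bump_def
  by (intro allI Ck_prod Ck_mult Ck_exp_inv_coordinate) auto

lemma box_bump_eq_0: "x \<notin> box a b \<Longrightarrow> box_bump m a b x = 0"
proof -
  assume "x \<notin> box a b"
  then obtain i where "x $ i \<le> a $ i \<or> b $ i \<le> x $ i"
    by (auto simp: mem_box_cart not_less)
  then show ?thesis
    unfolding box_bump_def by (intro prod_zero bexI[of _ i]) (auto simp: exp_inv_def)
qed

lemma box_bump_bounded: "\<bar>box_bump m a b x\<bar> \<le> 1"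
proof -
  have "0 \<le> exp_inv (1 / Suc m) 1 t" "exp_inv (1 / Suc m) 1 t \<le> 1" for t
    by (auto simp: exp_inv_def)
  then show ?thesis
    unfolding box_bump_def abs_prod by (intro prod_le_1) (auto simp: abs_mult intro!: mult_le_one)
qed

lemma box_bump_tendsto: "(\<lambda>m. box_bump m a b x) \<longlonglongrightarrow> indicator (box a b) x"
proof (cases "x \<in> box a b")
  case True
  have lim: "(\<lambda>m. exp_inv (1 / Suc m) 1 t) \<longlonglongrightarrow> 1" if "t > 0" for t
  proof -
    have "(\<lambda>m. - (1 / real (Suc m)) / t) \<longlonglongrightarrow> - 0 / t"
      using that by (intro tendsto_intros LIMSEQ_Suc[OF lim_1_over_n]) auto
    from tendsto_exp[OF this] show ?thesis
      using that by (simp add: exp_inv_def)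
  qed
  have "(\<lambda>m. box_bump m a b x) \<longlonglongrightarrow> (\<Prod>i\<in>(UNIV::'a set). 1 * 1)"
    unfolding box_bump_def
    by (intro tendsto_prod tendsto_mult lim) (use True in \<open>auto simp: mem_box_cart\<close>)
  with True show ?thesis by simp
qed (simp add: box_bump_eq_0)

text \<open>The compact set is \<open>cbox a b\<close>, so the closed box and not just the open one
  is asked to lie in \<open>D\<close>.\<close>

lemma box_bump_test_function:
  assumes "cbox a b \<subseteq> D"
  shows "box_bump m a b \<in> test_functions D"
  using assms box_bump_eq_0[of _ a b m] box_subset_cbox[of a b]
  by (auto simp: test_functions_def smooth_box_bump intro!: exI[of _ "cbox a b"])

section \<open>Uniqueness and linearity of weak gradients\<close>

lemma continuous_imp_measurable_lebesgue_on:
  fixes f :: "real^'n \<Rightarrow> real"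
  assumes "continuous_on UNIV f"
  shows "f \<in> borel_measurable (lebesgue_on D)"
  using borel_measurable_continuous_onI[OF assms]
  by (intro measurable_restrict_space1 measurable_completion) simp

lemma smooth_imp_continuous: "smooth f \<Longrightarrow> continuous_on UNIV f"
  unfolding smooth_def by (metis Ck.simps(1))

text \<open>Dominated convergence along the bumps, with majorant |g| because the bumps are bounded
  by 1.\<close>

lemma test_function_orthogonal_box:
  fixes g :: "real^'n \<Rightarrow> real"
  assumes g: "integrable (lebesgue_on D) g"
    and orth: "\<And>\<phi>. \<phi> \<in> test_functions D \<Longrightarrow> (LINT x|lebesgue_on D. g x * \<phi> x) = 0"
    and sub: "cbox a b \<subseteq> D"
  shows "(LINT x|lebesgue_on D. g x * indicator (box a b) x) = 0"
proof -
  have [measurable]: "g \<in> borel_measurable (lebesgue_on D)"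
    using g by auto
  have [measurable]: "indicator (box a b) \<in> borel_measurable (lebesgue_on D)"
    by (intro measurable_restrict_space1 borel_measurable_indicator) auto
  have [measurable]: "box_bump m a b \<in> borel_measurable (lebesgue_on D)" for m
    by (intro continuous_imp_measurable_lebesgue_on smooth_imp_continuous smooth_box_bump)
  have "(\<lambda>m. LINT x|lebesgue_on D. g x * box_bump m a b x) \<longlonglongrightarrow>
      (LINT x|lebesgue_on D. g x * indicator (box a b) x)"
  proof (rule integral_dominated_convergence[where w = "\<lambda>x. \<bar>g x\<bar>"])
    show "AE x in lebesgue_on D. norm (g x * box_bump m a b x) \<le> \<bar>g x\<bar>" for m
      using box_bump_bounded[of m a b] by (auto simp: abs_mult intro!: mult_left_le)
  qed (use g in \<open>auto intro!: tendsto_mult box_bump_tendsto\<close>)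
  then show ?thesis
    using orth[OF box_bump_test_function[OF sub]] by (simp add: LIMSEQ_const_iff)
qed

text \<open>Open boxes are stable under intersection and generate the Borel sets, and the sets with
  vanishing integral are closed under countable disjoint unions and, by \<open>total\<close>, under
  complements. So the integral vanishes over every Borel set, and \<open>f\<close> agrees with the
  zero function.\<close>

lemma AE_zero_if_box_integrals_zero:
  fixes f :: "'a::euclidean_space \<Rightarrow> real"
  assumes f: "integrable lborel f"
    and total: "(LINT x|lborel. f x) = 0"
    and zero: "\<And>l u. (LINT x:box l u|lborel. f x) = 0"
  shows "AE x in lborel. f x = 0"
proof -
  have "(LINT x:A|lborel. f x) = 0" if "A \<in> sets lborel" for A
  proof -
    let ?E = "range (\<lambda>(a, b). box a b :: 'a set)"
    have "Int_stable ?E"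
      by (auto simp: Int_stable_def box_Int_box)
    moreover have "?E \<subseteq> Pow UNIV"
      by simp
    moreover have "A \<in> sigma_sets UNIV ?E"
      using that by (simp add: borel_eq_box)
    ultimately show ?thesis
    proof (induction rule: sigma_sets_induct_disjoint)
      case (basic A)
      then show ?case using zero by auto
    next
      case empty
      then show ?case by (simp add: set_lebesgue_integral_def)
    next
      case (compl A)
      then have [measurable]: "A \<in> sets borel" by (simp add: borel_eq_box)
      have "(LINT x:UNIV - A|lborel. f x) = (LINT x|lborel. f x - indicator A x *\<^sub>R f x)"
        unfolding set_lebesgue_integral_def
        by (rule Bochner_Integration.integral_cong) (auto simp: indicator_def)
      also have "\<dots> = (LINT x|lborel. f x) - (LINT x:A|lborel. f x)"
        unfolding set_lebesgue_integral_def using f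
        by (intro Bochner_Integration.integral_diff integrable_mult_indicator) auto
      finally show ?case using compl total by simp
    next
      case (union A)
      then have [measurable]: "A i \<in> sets borel" for i by (auto simp: borel_eq_box)
      have "(LINT x:(\<Union>i. A i)|lborel. f x) = (\<Sum>i. LINT x:A i|lborel. f x)"
      proof (rule lebesgue_integral_countable_add)
        show "set_integrable lborel (\<Union>i. A i) f"
          unfolding set_integrable_def using f by (intro integrable_mult_indicator) auto
      qed (use union in \<open>auto simp: disjoint_family_on_def\<close>)
      then show ?case using union by simp
    qed
  qed
  then show ?thesis
    using f by (intro density_unique_real) (auto simp: set_lebesgue_integral_def)
qed

text \<open>On each closed box inside \<open>D\<close> the function vanishes almost everywhere
  because its integrals over all open subboxes do; countably many such closed boxes cover
  \<open>D\<close>.\<close>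

lemma fundamental_lemma_calculus_of_variations:
  fixes g :: "real^'n \<Rightarrow> real"
  assumes "open D" and g: "integrable (lebesgue_on D) g"
    and orth: "\<And>\<phi>. \<phi> \<in> test_functions D \<Longrightarrow> (LINT x|lebesgue_on D. g x * \<phi> x) = 0"
  shows "AE x in lebesgue_on D. g x = 0"
proof -
  have D[measurable]: "D \<in> sets lebesgue"
    using \<open>open D\<close> by simp
  have AE_cbox: "AE x in lebesgue. x \<in> cbox a b \<longrightarrow> g x = 0" if sub: "cbox a b \<subseteq> D" for a b
  proof -
    \<comment> \<open>Cutting \<open>g\<close> off to the open box makes every box admissible:
      \<open>box l u\<close> meets \<open>box a b\<close> in a box whose closure, unless it is
      empty, stays inside \<open>cbox a b\<close>.\<close>
    define f where "f x = indicator (box a b) x * (indicator D x * g x)" for x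
    have f: "integrable lebesgue f"
    proof -
      have "integrable lebesgue (\<lambda>x. indicator D x *\<^sub>R g x)"
        using g D by (subst integrable_restrict_space[symmetric]) auto
      from integrable_mult_indicator[OF _ this, of "box a b"] show ?thesis
        unfolding f_def by simp
    qed
    have box_zero: "(LINT x|lebesgue. indicator (box l u) x * f x) = 0" for l u
    proof -
      obtain c d where cd: "box l u \<inter> box a b = box c d"
        by (rule that[OF box_Int_box])
      have "(LINT x|lebesgue. indicator (box l u) x * f x) =
          (LINT x|lebesgue. indicator D x *\<^sub>R (g x * indicator (box c d) x))"
        by (rule Bochner_Integration.integral_cong)
           (auto simp: f_def cd[symmetric] indicator_def)
      also have "\<dots> = (LINT x|lebesgue_on D. g x * indicator (box c d) x)"
        using D by (subst integral_restrict_space) auto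
      also have "\<dots> = 0"
      proof (cases "box c d = {}")
        case False
        have "cbox c d = closure (box c d)"
          using False by (simp add: closure_box)
        also have "\<dots> \<subseteq> cbox a b"
          unfolding cd[symmetric] using box_subset_cbox by (intro closure_minimal) auto
        finally show ?thesis
          using sub g orth by (intro test_function_orthogonal_box) auto
      qed simp
      finally show ?thesis .
    qed
    \<comment> \<open>\<open>f\<close> is only Lebesgue measurable, while the argument by boxes runs
      over Borel sets and \<open>lborel\<close>; hence the Borel representative
      \<open>f'\<close>.\<close>
    obtain f' where f'[measurable]: "f' \<in> borel_measurable lborel"
      and ff': "AE x in lborel. f x = f' x"
      using completion_ex_borel_measurable_real borel_measurable_integrable[OF f] by blast
    have [measurable]: "f \<in> borel_measurable lebesgue" "f' \<in> borel_measurable lebesgue"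
      using f f' by (auto intro: measurable_completion)
    have ff'_leb: "AE x in lebesgue. f x = f' x"
      using ff' by (rule AE_completion)
    have "integrable lebesgue f'"
      using f ff'_leb integrable_cong_AE[of f lebesgue f'] by simp
    then have f'_int: "integrable lborel f'"
      using f' by (simp add: integrable_completion)
    have eq: "(LINT x|lborel. indicator A x * f' x) = (LINT x|lebesgue. indicator A x * f x)"
      if [measurable]: "A \<in> sets borel" for A
    proof -
      have "(LINT x|lborel. indicator A x * f' x) = (LINT x|lebesgue. indicator A x * f' x)"
        by (rule integral_completion[symmetric]) measurable
      also have "\<dots> = (LINT x|lebesgue. indicator A x * f x)"
        using ff'_leb
        by (intro integral_cong_AE borel_measurable_times borel_measurable_indicator) auto
      finally show ?thesis .
    qed
    \<comment> \<open>The total integral is itself a box integral, since \<open>f\<close> vanishes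
      off \<open>box a b\<close>.\<close>
    have "(LINT x|lborel. indicator UNIV x * f' x) = (LINT x|lebesgue. indicator UNIV x * f x)"
      by (rule eq) simp
    also have "\<dots> = (LINT x|lebesgue. indicator (box a b) x * f x)"
      by (rule Bochner_Integration.integral_cong) (auto simp: f_def indicator_def)
    finally have "AE x in lborel. f' x = 0"
      using f'_int by (intro AE_zero_if_box_integrals_zero)
        (auto simp: set_lebesgue_integral_def eq box_zero)
    with ff' have "AE x in lborel. f x = 0" by eventually_elim simp
    then have "AE x in lebesgue. f x = 0" by (rule AE_completion)
    \<comment> \<open>The open box misses only the boundary of the closed one, a null set.\<close>
    moreover have "AE x in lebesgue. x \<notin> cbox a b - box a b"
      using negligible_frontier_interval[of a b] negligible_iff_null_sets AE_not_in by blast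
    ultimately show ?thesis
    proof eventually_elim
      case (elim x)
      then show ?case using sub by (auto simp: f_def indicator_def split: if_splits)
    qed
  qed
  \<comment> \<open>Each index encodes the two corners of a box with rational coordinates. There are
    countably many, so the exceptional null sets can be united.\<close>
  let ?a = "\<lambda>f::real^'n \<Rightarrow> real \<times> real. (\<Sum>i\<in>Basis. fst (f i) *\<^sub>R i)"
  let ?b = "\<lambda>f::real^'n \<Rightarrow> real \<times> real. (\<Sum>i\<in>Basis. snd (f i) *\<^sub>R i)"
  define I where "I = {f\<in>Basis \<rightarrow>\<^sub>E \<rat> \<times> \<rat>. cbox (?a f) (?b f) \<subseteq> D}"
  have "countable ((Basis :: (real^'n) set) \<rightarrow>\<^sub>E (\<rat> \<times> \<rat> :: (real \<times> real) set))"
    by (intro countable_PiE countable_SIGMA countable_rat finite_Basis)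
  then have "countable I"
    by (rule countable_subset[rotated]) (auto simp: I_def)
  moreover have "AE x in lebesgue. x \<in> cbox (?a f) (?b f) \<longrightarrow> g x = 0" if "f \<in> I" for f
    using that by (intro AE_cbox) (auto simp: I_def)
  ultimately have "AE x in lebesgue. \<forall>f\<in>I. x \<in> cbox (?a f) (?b f) \<longrightarrow> g x = 0"
    by (intro AE_ball_countable[THEN iffD2] ballI)
  then have "AE x in lebesgue. x \<in> D \<longrightarrow> g x = 0"
  proof eventually_elim
    case (elim x)
    moreover have "D = (\<Union>f\<in>I. cbox (?a f) (?b f))"
      unfolding I_def by (rule open_UNION_cbox[OF \<open>open D\<close>])
    ultimately show ?case by blast
  qed
  then show ?thesis
    using D by (simp add: AE_restrict_space_iff)
qed

section \<open>Square-integrable functions on a bounded open set\<close>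

lemma finite_measure_lebesgue_on_bounded:
  "open D \<Longrightarrow> bounded D \<Longrightarrow> finite_measure (lebesgue_on (D :: (real^'n) set))"
  by (intro finite_measure_lebesgue_on) (simp add: lmeasurable_open)

lemma L2_measurable: "f \<in> L2 D \<Longrightarrow> f \<in> borel_measurable (lebesgue_on D)"
  by (simp add: L2_def)

lemma L2_square_integrable: "f \<in> L2 D \<Longrightarrow> integrable (lebesgue_on D) (\<lambda>x. (norm (f x))\<^sup>2)"
  by (simp add: L2_def)

lemma L2_bound:
  assumes "f \<in> L2 D" "g \<in> borel_measurable (lebesgue_on D)"
    "AE x in lebesgue_on D. norm (g x) \<le> C * norm (f x)"
  shows "g \<in> L2 D"
proof -
  have "integrable (lebesgue_on D) (\<lambda>x. C\<^sup>2 * (norm (f x))\<^sup>2)"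
    using assms(1) by (simp add: L2_def)
  then have "integrable (lebesgue_on D) (\<lambda>x. (norm (g x))\<^sup>2)"
  proof (rule Bochner_Integration.integrable_bound)
    show "AE x in lebesgue_on D. norm ((norm (g x))\<^sup>2) \<le> norm (C\<^sup>2 * (norm (f x))\<^sup>2)"
      using assms(3)
    proof eventually_elim
      case (elim x)
      then have "(norm (g x))\<^sup>2 \<le> (C * norm (f x))\<^sup>2" by (intro power_mono) auto
      then show ?case by (simp add: power_mult_distrib)
    qed
  qed (use assms(2) in measurable)
  then show ?thesis using assms(2) by (simp add: L2_def)
qed

lemma L2_lincomb:
  assumes f: "f \<in> L2 D" and g: "g \<in> L2 D"
  shows "(\<lambda>x. a *\<^sub>R f x + b *\<^sub>R g x) \<in> L2 D"
proof -
  note [measurable] = L2_measurable[OF f] L2_measurable[OF g]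
  have "integrable (lebesgue_on D) (\<lambda>x. 2 * a\<^sup>2 * (norm (f x))\<^sup>2 + 2 * b\<^sup>2 * (norm (g x))\<^sup>2)"
    using f g by (simp add: L2_def)
  then have "integrable (lebesgue_on D) (\<lambda>x. (norm (a *\<^sub>R f x + b *\<^sub>R g x))\<^sup>2)"
  proof (rule Bochner_Integration.integrable_bound, measurable, intro AE_I2)
    fix x
    have "(norm (a *\<^sub>R f x + b *\<^sub>R g x))\<^sup>2 \<le> (norm (a *\<^sub>R f x) + norm (b *\<^sub>R g x))\<^sup>2"
      by (intro power_mono norm_triangle_ineq) auto
    also have "\<dots> \<le> 2 * (norm (a *\<^sub>R f x))\<^sup>2 + 2 * (norm (b *\<^sub>R g x))\<^sup>2"
      using sum_squares_bound[of "norm (a *\<^sub>R f x)" "norm (b *\<^sub>R g x)"] by (simp add: power2_sum)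
    also have "\<dots> = 2 * a\<^sup>2 * (norm (f x))\<^sup>2 + 2 * b\<^sup>2 * (norm (g x))\<^sup>2"
      by (simp add: power_mult_distrib)
    finally show "norm ((norm (a *\<^sub>R f x + b *\<^sub>R g x))\<^sup>2) \<le>
        norm (2 * a\<^sup>2 * (norm (f x))\<^sup>2 + 2 * b\<^sup>2 * (norm (g x))\<^sup>2)"
      by simp
  qed
  then show ?thesis by (simp add: L2_def)
qed

lemma L2_inner_integrable:
  assumes f: "f \<in> L2 D" and g: "g \<in> L2 D"
  shows "integrable (lebesgue_on D) (\<lambda>x. f x \<bullet> g x)"
proof -
  note [measurable] = L2_measurable[OF f] L2_measurable[OF g]
  have "integrable (lebesgue_on D) (\<lambda>x. (norm (f x))\<^sup>2 + (norm (g x))\<^sup>2)"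
    using f g by (simp add: L2_def)
  then show ?thesis
  proof (rule Bochner_Integration.integrable_bound, measurable, intro AE_I2)
    fix x
    have "\<bar>f x \<bullet> g x\<bar> \<le> norm (f x) * norm (g x)" by (rule Cauchy_Schwarz_ineq2)
    also have "\<dots> \<le> (norm (f x))\<^sup>2 + (norm (g x))\<^sup>2"
      using sum_squares_bound[of "norm (f x)" "norm (g x)"]
        mult_nonneg_nonneg[OF norm_ge_zero[of "f x"] norm_ge_zero[of "g x"]] by linarith
    finally show "norm (f x \<bullet> g x) \<le> norm ((norm (f x))\<^sup>2 + (norm (g x))\<^sup>2)" by simp
  qed
qed

lemma L2_const: "open D \<Longrightarrow> bounded D \<Longrightarrow> (\<lambda>x. c) \<in> L2 D"
  using finite_measure.integrable_const[OF finite_measure_lebesgue_on_bounded] by (simp add: L2_def)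

text \<open>Pair with the constant 1, which lies in \<open>L2 D\<close> because \<open>D\<close> has
  finite measure.\<close>

lemma L2_integrable:
  assumes "open D" "bounded D" "f \<in> L2 D"
  shows "integrable (lebesgue_on D) f"
proof -
  have "integrable (lebesgue_on D) (\<lambda>x. norm (f x) \<bullet> 1)"
  proof (rule L2_inner_integrable)
    show "(\<lambda>x. norm (f x)) \<in> L2 D" using assms(3) by (auto simp: L2_def)
    show "(\<lambda>x. 1) \<in> L2 D" using assms(1,2) by (rule L2_const)
  qed
  then show ?thesis
    using integrable_norm_iff[OF L2_measurable[OF assms(3)]] by simp
qed

lemma L2_component: "g \<in> L2 D \<Longrightarrow> (\<lambda>x. (g x :: real^'m) $ i) \<in> L2 D"
  by (rule L2_bound[where C = 1])
     (auto simp: L2_def component_le_norm_cart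
        intro: measurable_compose[OF _ borel_measurable_continuous_onI[OF continuous_on_component]])

text \<open>A continuous \<open>h\<close> is bounded on the compact closure of \<open>D\<close>. It
  will be a test function or one of its partial derivatives.\<close>

lemma integrable_mult_continuous:
  fixes f h :: "real^'n \<Rightarrow> real"
  assumes "bounded D" "D \<in> sets lebesgue" and f: "integrable (lebesgue_on D) f" and h: "continuous_on UNIV h"
  shows "integrable (lebesgue_on D) (\<lambda>x. f x * h x)"
proof -
  have "compact (closure D)" using \<open>bounded D\<close> by simp
  then have "compact (h ` closure D)"
    using h by (intro compact_continuous_image continuous_on_subset[OF h]) auto
  then have "bounded (h ` closure D)" by (rule compact_imp_bounded)
  then obtain C where C: "\<And>x. x \<in> closure D \<Longrightarrow> \<bar>h x\<bar> \<le> C"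
    by (auto simp: bounded_iff)
  have "integrable (lebesgue_on D) (\<lambda>x. C * f x)" using f by simp
  then show ?thesis
  proof (rule Bochner_Integration.integrable_bound)
    show "(\<lambda>x. f x * h x) \<in> borel_measurable (lebesgue_on D)"
      using f continuous_imp_measurable_lebesgue_on[OF h] by (intro borel_measurable_times) auto
    have "norm (f x * h x) \<le> norm (C * f x)" if "x \<in> D" for x
    proof -
      have "\<bar>h x\<bar> \<le> \<bar>C\<bar>" using C[of x] that closure_subset by fastforce
      then show ?thesis
        by (simp add: abs_mult mult.commute[of _ "\<bar>f x\<bar>"] mult_left_mono)
    qed
    then show "AE x in lebesgue_on D. norm (f x * h x) \<le> norm (C * f x)"
      using assms(2) by (intro AE_I2) auto
  qed
qed

section \<open>Weak gradients and the space \<open>H1 D\<close>\<close>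

lemma test_function_continuous:
  assumes "\<phi> \<in> test_functions D"
  shows "continuous_on UNIV \<phi>" "continuous_on UNIV (partial_deriv i \<phi>)"
proof -
  have "Ck 0 \<phi>" "Ck (Suc 0) \<phi>"
    using assms by (auto simp: test_functions_def smooth_def simp del: Ck.simps)
  then show "continuous_on UNIV \<phi>" "continuous_on UNIV (partial_deriv i \<phi>)" by auto
qed

text \<open>Both sides of the defining identity are linear. Splitting the integrals requires each
  product to be integrable, which is where the boundedness of \<open>D\<close> enters.\<close>

lemma has_weak_gradient_lincomb:
  assumes D: "open D" "bounded D"
    and u: "u \<in> L2 D" "g \<in> L2 D" "has_weak_gradient D u g"
    and w: "w \<in> L2 D" "h \<in> L2 D" "has_weak_gradient D w h"
  shows "has_weak_gradient D (\<lambda>x. a * u x + b * w x) (\<lambda>x. a *\<^sub>R g x + b *\<^sub>R h x)"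
  unfolding has_weak_gradient_def
proof (intro ballI allI)
  fix \<phi> i assume \<phi>: "\<phi> \<in> test_functions D"
  have int: "integrable (lebesgue_on D) (\<lambda>x. f x * k x)"
    if "f \<in> L2 D" "continuous_on UNIV k" for f k :: "_ \<Rightarrow> real"
    by (rule integrable_mult_continuous[OF D(2) _ L2_integrable[OF D that(1)] that(2)]) (simp add: D)
  note cont = test_function_continuous[OF \<phi>]
  have "(LINT x|lebesgue_on D. (a * u x + b * w x) * partial_deriv i \<phi> x) =
      (LINT x|lebesgue_on D. a * (u x * partial_deriv i \<phi> x) + b * (w x * partial_deriv i \<phi> x))"
    by (simp add: algebra_simps)
  also have "\<dots> = a * (LINT x|lebesgue_on D. u x * partial_deriv i \<phi> x) +
      b * (LINT x|lebesgue_on D. w x * partial_deriv i \<phi> x)"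
    using int[OF u(1) cont(2)] int[OF w(1) cont(2)] by simp
  also have "\<dots> = - (a * (LINT x|lebesgue_on D. g x $ i * \<phi> x) + b * (LINT x|lebesgue_on D. h x $ i * \<phi> x))"
    using u(3) w(3) \<phi> by (simp add: has_weak_gradient_def)
  also have "\<dots> = - (LINT x|lebesgue_on D. a * (g x $ i * \<phi> x) + b * (h x $ i * \<phi> x))"
    using int[OF L2_component[OF u(2)] cont(1)] int[OF L2_component[OF w(2)] cont(1)] by simp
  finally show "(LINT x|lebesgue_on D. (a * u x + b * w x) * partial_deriv i \<phi> x) =
      - (LINT x|lebesgue_on D. (a *\<^sub>R g x + b *\<^sub>R h x) $ i * \<phi> x)"
    by (simp add: algebra_simps)
qed

text \<open>Each component of the difference is integrable and orthogonal to all test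
  functions.\<close>

lemma weak_gradient_unique:
  assumes D: "open D" "bounded D"
    and g: "g \<in> L2 D" "has_weak_gradient D u g"
    and h: "h \<in> L2 D" "has_weak_gradient D u h"
  shows "AE x in lebesgue_on D. g x = h x"
proof -
  have "AE x in lebesgue_on D. g x $ i - h x $ i = 0" for i
  proof (rule fundamental_lemma_calculus_of_variations[OF D(1)])
    have int: "integrable (lebesgue_on D) (\<lambda>x. g x $ i)" "integrable (lebesgue_on D) (\<lambda>x. h x $ i)"
      using g h D by (auto intro: L2_integrable L2_component)
    then show "integrable (lebesgue_on D) (\<lambda>x. g x $ i - h x $ i)" by simp
    fix \<phi> assume \<phi>: "\<phi> \<in> test_functions D"
    have "integrable (lebesgue_on D) (\<lambda>x. g x $ i * \<phi> x)" "integrable (lebesgue_on D) (\<lambda>x. h x $ i * \<phi> x)"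
      using int D test_function_continuous[OF \<phi>] by (auto intro!: integrable_mult_continuous)
    then have "(LINT x|lebesgue_on D. (g x $ i - h x $ i) * \<phi> x) =
        (LINT x|lebesgue_on D. g x $ i * \<phi> x) - (LINT x|lebesgue_on D. h x $ i * \<phi> x)"
      by (simp add: left_diff_distrib)
    also have "\<dots> = 0"
      using g(2) h(2) \<phi> by (auto simp: has_weak_gradient_def)
    finally show "(LINT x|lebesgue_on D. (g x $ i - h x $ i) * \<phi> x) = 0" .
  qed
  then have "AE x in lebesgue_on D. \<forall>i\<in>UNIV. g x $ i - h x $ i = 0"
    by (intro AE_finite_allI) auto
  then show ?thesis by eventually_elim (simp add: vec_eq_iff)
qed

lemma weak_grad_works:
  assumes "u \<in> H1 D"
  shows "weak_grad D u \<in> L2 D" "has_weak_gradient D u (weak_grad D u)"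
proof -
  have "\<exists>g. g \<in> L2 D \<and> has_weak_gradient D u g"
    using assms by (auto simp: H1_def)
  from someI_ex[OF this] show "weak_grad D u \<in> L2 D" "has_weak_gradient D u (weak_grad D u)"
    by (simp_all add: weak_grad_def)
qed

lemma H1_imp_L2: "u \<in> H1 D \<Longrightarrow> u \<in> L2 D"
  by (simp add: H1_def)

text \<open>The combination of the chosen gradients is one weak gradient of the combination, but the
  choice operator may pick another; uniqueness makes the two agree almost everywhere.\<close>

lemma
  assumes D: "open D" "bounded D" and u: "u \<in> H1 D" and w: "w \<in> H1 D"
  shows H1_lincomb: "(\<lambda>x. a * u x + b * w x) \<in> H1 D"
    and weak_grad_lincomb: "AE x in lebesgue_on D.
      weak_grad D (\<lambda>x. a * u x + b * w x) x = a *\<^sub>R weak_grad D u x + b *\<^sub>R weak_grad D w x"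
proof -
  let ?g = "\<lambda>x. a *\<^sub>R weak_grad D u x + b *\<^sub>R weak_grad D w x"
  have g: "?g \<in> L2 D" "has_weak_gradient D (\<lambda>x. a * u x + b * w x) ?g"
    using u w D by (auto intro!: L2_lincomb has_weak_gradient_lincomb weak_grad_works H1_imp_L2)
  moreover have "(\<lambda>x. a * u x + b * w x) \<in> L2 D"
    using L2_lincomb[OF H1_imp_L2[OF u] H1_imp_L2[OF w]] by simp
  ultimately show H1: "(\<lambda>x. a * u x + b * w x) \<in> H1 D"
    by (auto simp: H1_def)
  show "AE x in lebesgue_on D. weak_grad D (\<lambda>x. a * u x + b * w x) x = ?g x"
    by (rule weak_gradient_unique[OF D weak_grad_works[OF H1] g])
qed

section \<open>Elementary bounds for the norms\<close>

lemma weak_grad_L2_norm_le: "sqrt (LINT x|lebesgue_on D. (norm (weak_grad D u x))\<^sup>2) \<le> H1_norm D u"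
  unfolding H1_norm_def by (intro real_sqrt_le_mono) (simp add: integral_nonneg_AE)

lemma H1_norm_nonneg: "0 \<le> H1_norm D u"
  unfolding H1_norm_def by (simp add: integral_nonneg_AE)

text \<open>Membership in \<open>Linf D\<close> excludes plus infinity as essential supremum, and
  minus infinity is absurd at any point where the bound holds, so \<open>real_of_ereal\<close> loses
  nothing.\<close>

lemma Linf_norm_works:
  assumes "f \<in> Linf D"
  shows "AE x in lebesgue_on D. \<bar>f x\<bar> \<le> Linf_norm D f"
proof -
  have "AE x in lebesgue_on D. ereal \<bar>f x\<bar> \<le> esssup (lebesgue_on D) (\<lambda>x. ereal \<bar>f x\<bar>)"
    by (rule esssup_AE)
  then show ?thesis
  proof eventually_elim
    case (elim x)
    with assms show ?case
      by (cases "esssup (lebesgue_on D) (\<lambda>x. ereal \<bar>f x\<bar>)") (auto simp: Linf_norm_def Linf_def)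
  qed
qed

text \<open>On a space of measure zero the essential supremum is minus infinity, and for a
  non-measurable function it is plus infinity; \<open>real_of_ereal\<close> sends both to 0.
  Otherwise compare with the constant 0.\<close>

lemma Linf_norm_nonneg: "0 \<le> Linf_norm D f"
proof (cases "emeasure (lebesgue_on D) (space (lebesgue_on D)) = 0 \<or>
    (\<lambda>x. ereal \<bar>f x\<bar>) \<notin> borel_measurable (lebesgue_on D)")
  case True
  then show ?thesis
    using esssup_zero_space[of "lebesgue_on D" "\<lambda>x. ereal \<bar>f x\<bar>"]
      esssup_non_measurable[of "\<lambda>x. ereal \<bar>f x\<bar>" "lebesgue_on D"]
    by (cases "(\<lambda>x. ereal \<bar>f x\<bar>) \<in> borel_measurable (lebesgue_on D)")
       (auto simp: Linf_norm_def top_ereal_def)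
next
  case False
  then have "0 = esssup (lebesgue_on D) (\<lambda>x. 0::ereal)"
    by (simp add: esssup_const)
  also have "\<dots> \<le> esssup (lebesgue_on D) (\<lambda>x. ereal \<bar>f x\<bar>)"
    by (rule esssup_mono) auto
  finally show ?thesis unfolding Linf_norm_def by (rule real_of_ereal_pos)
qed

section \<open>Pointwise estimates\<close>

definition elastic_density :: "real \<Rightarrow> real \<Rightarrow> real \<Rightarrow> real" where
  "elastic_density \<alpha> b s = s / (2 * (1 + b * s powr \<alpha>) powr (1 / \<alpha>))"

text \<open>Twice the derivative of \<open>elastic_density\<close>, so that the gradient of
  \<open>elastic_density \<alpha> b ((norm T)\<^sup>2)\<close> in \<open>T\<close> is
  \<open>stiffness \<alpha> b ((norm T)\<^sup>2) *\<^sub>R T\<close>.\<close>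

definition stiffness :: "real \<Rightarrow> real \<Rightarrow> real \<Rightarrow> real" where
  "stiffness \<alpha> b s = (1 + b * s powr \<alpha>) powr (- 1 / \<alpha> - 1)"

definition degradation :: "real \<Rightarrow> real \<Rightarrow> real" where
  "degradation \<kappa> v = sqrt ((1 - \<kappa>) * v\<^sup>2 + \<kappa>)"

text \<open>With \<open>w = 1 + b * s powr \<alpha>\<close>, the product rule leaves the common
  factor \<open>w powr (- 1 / \<alpha> - 1) / 2\<close> times
  \<open>w - b * s powr \<alpha>\<close>, which is 1.\<close>

lemma elastic_density_has_real_derivative:
  assumes "\<alpha> > 0" "b \<ge> 0" "s > 0"
  shows "(elastic_density \<alpha> b has_real_derivative stiffness \<alpha> b s / 2) (at s)"
proof -
  let ?w = "\<lambda>s. 1 + b * s powr \<alpha>"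
  have w: "?w s > 0" using assms by (simp add: add_pos_nonneg)
  have "((\<lambda>s. s / 2 * ?w s powr (- 1 / \<alpha>)) has_real_derivative
      1 / 2 * ?w s powr (- 1 / \<alpha>) +
      s / 2 * ((- 1 / \<alpha>) * ?w s powr (- 1 / \<alpha> - 1) * (b * (\<alpha> * s powr (\<alpha> - 1))))) (at s)"
  proof -
    have "(?w has_real_derivative b * (\<alpha> * s powr (\<alpha> - 1))) (at s)"
      using assms by (auto intro!: derivative_eq_intros)
    from DERIV_mult[OF DERIV_cdivide[OF DERIV_ident] DERIV_fun_powr[OF this w, of "- 1 / \<alpha>"], of 2]
    show ?thesis by (simp add: algebra_simps)
  qed
  also have "1 / 2 * ?w s powr (- 1 / \<alpha>) +
      s / 2 * ((- 1 / \<alpha>) * ?w s powr (- 1 / \<alpha> - 1) * (b * (\<alpha> * s powr (\<alpha> - 1)))) = stiffness \<alpha> b s / 2"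
  proof -
    have 1: "?w s powr (- 1 / \<alpha>) = ?w s * stiffness \<alpha> b s"
      using w by (simp add: stiffness_def powr_diff)
    have 2: "s powr (\<alpha> - 1) = s powr \<alpha> / s"
      using assms by (simp add: powr_diff)
    show ?thesis
      unfolding 1 2 stiffness_def[symmetric] using assms by (simp add: field_simps)
  qed
  finally show ?thesis
    by (simp add: elastic_density_def[abs_def] powr_minus_divide)
qed

lemma stiffness_nonneg: "0 \<le> stiffness \<alpha> b s"
  by (simp add: stiffness_def)

text \<open>The exponent is negative while the base grows with \<open>s\<close>. This is the
  concavity of \<open>elastic_density\<close>.\<close>

lemma stiffness_antimono:
  assumes "\<alpha> > 0" "b \<ge> 0" "0 \<le> s" "s \<le> t"
  shows "stiffness \<alpha> b t \<le> stiffness \<alpha> b s"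
  unfolding stiffness_def using assms
  by (intro powr_mono2') (auto intro!: mult_left_mono powr_mono2 add_pos_nonneg simp: field_simps)

lemma stiffness_le_1:
  assumes "\<alpha> > 0" "b \<ge> 0" "0 \<le> s"
  shows "stiffness \<alpha> b s \<le> 1"
  using stiffness_antimono[of \<alpha> b 0 s] assms by (simp add: stiffness_def)

lemma continuous_on_elastic_density:
  assumes "\<alpha> > 0" "b \<ge> 0"
  shows "continuous_on {0..} (elastic_density \<alpha> b)"
proof -
  have "1 + b * s powr \<alpha> > 0" for s using assms by (simp add: add_pos_nonneg)
  moreover from this have "1 + b * s powr \<alpha> \<noteq> 0" for s by (metis less_irrefl)
  ultimately show ?thesis
    unfolding elastic_density_def using assms
    by (intro continuous_intros continuous_on_powr') auto
qed

lemma continuous_on_stiffness: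
  assumes "\<alpha> > 0" "b \<ge> 0"
  shows "continuous_on {0..} (stiffness \<alpha> b)"
proof -
  have "1 + b * s powr \<alpha> > 0" for s using assms by (simp add: add_pos_nonneg)
  then have "1 + b * s powr \<alpha> \<noteq> 0" for s by (metis less_irrefl)
  then show ?thesis
    unfolding stiffness_def using assms
    by (intro continuous_intros continuous_on_powr') auto
qed

text \<open>By the mean value theorem a secant slope is an intermediate value of the increasing
  \<open>f'\<close>. Differentiability is asked for positive arguments only, as
  \<open>s powr \<alpha>\<close> may fail to be differentiable at 0; the value \<open>f' 0\<close>
  enters through \<open>mono\<close> alone, as a lower bound for slopes.\<close>

lemma tangent_line_le:
  fixes f f' :: "real \<Rightarrow> real"
  assumes cont: "continuous_on {0..} f"
    and der: "\<And>x. 0 < x \<Longrightarrow> (f has_real_derivative f' x) (at x)"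
    and mono: "\<And>x y. 0 \<le> x \<Longrightarrow> x \<le> y \<Longrightarrow> f' x \<le> f' y"
    and xy: "0 \<le> x" "0 \<le> y"
  shows "f x + f' x * (y - x) \<le> f y"
proof -
  have mvt: "\<exists>z. a < z \<and> z < b \<and> f b - f a = (b - a) * f' z" if "0 \<le> a" "a < b" for a b
  proof -
    have "\<exists>l z. a < z \<and> z < b \<and> DERIV f z :> l \<and> f b - f a = (b - a) * l"
      using that der by (intro MVT continuous_on_subset[OF cont])
        (auto simp: real_differentiable_def intro: order_le_less_trans)
    then obtain l z where z: "a < z" "z < b" "DERIV f z :> l" "f b - f a = (b - a) * l"
      by blast
    moreover have "l = f' z"
      using that z by (intro DERIV_unique[OF z(3) der]) auto
    ultimately show ?thesis by blast
  qed
  consider "x < y" | "y < x" | "x = y" by linarith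
  then show ?thesis
  proof cases
    case 1
    then obtain z where z: "x < z" "z < y" "f y - f x = (y - x) * f' z"
      using mvt xy by blast
    have "(y - x) * f' x \<le> (y - x) * f' z"
      using z xy by (intro mult_left_mono mono) auto
    then show ?thesis using z by (simp add: algebra_simps)
  next
    case 2
    then obtain z where z: "y < z" "z < x" "f x - f y = (x - y) * f' z"
      using mvt xy by blast
    have "(x - y) * f' z \<le> (x - y) * f' x"
      using z xy by (intro mult_left_mono mono) auto
    then show ?thesis using z by (simp add: algebra_simps)
  qed simp
qed

text \<open>Concavity in tangent form: the negative of the density has the increasing derivative
  \<open>- (stiffness \<alpha> b s / 2)\<close>.\<close>

lemma elastic_density_diff_le:
  assumes "\<alpha> > 0" "b \<ge> 0" "0 \<le> s" "0 \<le> s'"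
  shows "elastic_density \<alpha> b s' - elastic_density \<alpha> b s \<le> stiffness \<alpha> b s / 2 * (s' - s)"
proof -
  have "- elastic_density \<alpha> b s + - (stiffness \<alpha> b s / 2) * (s' - s) \<le> - elastic_density \<alpha> b s'"
    using assms
    by (intro tangent_line_le[where f' = "\<lambda>s. - (stiffness \<alpha> b s / 2)"] DERIV_minus
        elastic_density_has_real_derivative continuous_on_minus continuous_on_elastic_density)
       (auto intro: stiffness_antimono)
  then show ?thesis by simp
qed

text \<open>The stress is the derivative of \<open>elastic_density \<alpha> b (t\<^sup>2)\<close> in
  \<open>t\<close>. Its own derivative is \<open>k - 2 * (1 + \<alpha>) * (k * q)\<close> with the
  stiffness \<open>k\<close> and the fraction \<open>q = b * t\<^sup>2 powr \<alpha> / w\<close>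
  both in [0, 1].\<close>

lemma stress_has_real_derivative:
  assumes "\<alpha> > 0" "b \<ge> 0" "t > 0"
  shows "\<exists>d \<ge> - (2 * (1 + \<alpha>)). ((\<lambda>t. t * stiffness \<alpha> b (t\<^sup>2)) has_real_derivative d) (at t)"
proof -
  let ?s = "t\<^sup>2"
  let ?w = "1 + b * ?s powr \<alpha>"
  let ?d = "stiffness \<alpha> b ?s +
    t * ((- 1 / \<alpha> - 1) * ?w powr (- 1 / \<alpha> - 1 - 1) * (b * (\<alpha> * ?s powr (\<alpha> - 1) * (2 * t))))"
  have w: "?w \<ge> 1" using assms by simp
  then have w0: "?w > 0" by linarith
  have s: "?s > 0" using assms by simp
  have "((\<lambda>t. t * stiffness \<alpha> b (t\<^sup>2)) has_real_derivative ?d) (at t)"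
    unfolding stiffness_def using assms w0 s
    by (auto intro!: derivative_eq_intros)
  moreover have "?d \<ge> - (2 * (1 + \<alpha>))"
  proof -
    have 1: "?w powr (- 1 / \<alpha> - 1 - 1) = stiffness \<alpha> b ?s / ?w"
      using w0 by (simp only: stiffness_def powr_diff[of ?w "- 1 / \<alpha> - 1" 1] powr_one)
    have 2: "?s powr (\<alpha> - 1) = ?s powr \<alpha> / (t * t)"
      using s by (simp add: powr_diff power2_eq_square)
    have "?d = stiffness \<alpha> b ?s - 2 * (1 + \<alpha>) * (stiffness \<alpha> b ?s * (b * ?s powr \<alpha> / ?w))"
    proof -
      have "S + t * ((- 1 / \<alpha> - 1) * (S / w) * (b * (\<alpha> * (P / (t * t)) * (2 * t)))) =
          S - 2 * (1 + \<alpha>) * (S * (b * P / w))" if "w \<noteq> 0" for S P w :: real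
        using assms that by (simp add: field_simps)
      then show ?thesis unfolding 1 2 using w0 by simp
    qed
    moreover have "stiffness \<alpha> b ?s * (b * ?s powr \<alpha> / ?w) \<le> 1"
      using assms w0 by (intro mult_le_one stiffness_le_1) auto
    then have "2 * (1 + \<alpha>) * (stiffness \<alpha> b ?s * (b * ?s powr \<alpha> / ?w)) \<le> 2 * (1 + \<alpha>) * 1"
      using assms by (intro mult_left_mono) auto
    ultimately show ?thesis using stiffness_nonneg[of \<alpha> b ?s] by linarith
  qed
  ultimately show ?thesis by blast
qed

lemma elastic_density_square_diff_ge:
  assumes \<alpha>: "\<alpha> > 0" and b: "b \<ge> 0" and "0 \<le> t" "0 \<le> t'"
  shows "elastic_density \<alpha> b (t'\<^sup>2) - elastic_density \<alpha> b (t\<^sup>2) \<ge> stiffness \<alpha> b (t\<^sup>2) * t * (t' - t) - (1 + \<alpha>) * (t' - t)\<^sup>2"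
proof -
  \<comment> \<open>The added quadratic has second derivative \<open>2 * (1 + \<alpha>)\<close>,
    which offsets the lower bound of \<open>stress_has_real_derivative\<close> and makes
    \<open>?f'\<close> increasing; its tangent remainder is exactly
    \<open>(1 + \<alpha>) * (t' - t)\<^sup>2\<close>.\<close>
  let ?f = "\<lambda>t. elastic_density \<alpha> b (t\<^sup>2) + (1 + \<alpha>) * t\<^sup>2"
  let ?f' = "\<lambda>t. t * stiffness \<alpha> b (t\<^sup>2) + 2 * (1 + \<alpha>) * t"
  have "?f t + ?f' t * (t' - t) \<le> ?f t'"
  proof (rule tangent_line_le)
    show "continuous_on {0..} ?f"
      by (intro continuous_intros continuous_on_compose2[OF continuous_on_elastic_density[OF \<alpha> b]]) auto
    show "(?f has_real_derivative ?f' x) (at x)" if "0 < x" for x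
      using that by (auto intro!: derivative_eq_intros DERIV_chain'[OF _ elastic_density_has_real_derivative[OF \<alpha> b]])
    show "?f' x \<le> ?f' y" if "0 \<le> x" "x \<le> y" for x y
    proof (rule DERIV_nonneg_imp_increasing_open[OF \<open>x \<le> y\<close>])
      fix z assume "x < z" "z < y"
      then have "z > 0" using that by linarith
      from stress_has_real_derivative[OF \<alpha> b this] obtain d where
        "d \<ge> - (2 * (1 + \<alpha>))" "((\<lambda>t. t * stiffness \<alpha> b (t\<^sup>2)) has_real_derivative d) (at z)"
        by blast
      moreover have "((\<lambda>t. 2 * (1 + \<alpha>) * t) has_real_derivative 2 * (1 + \<alpha>)) (at z)"
        by (auto intro!: derivative_eq_intros)
      ultimately show "\<exists>d. (?f' has_real_derivative d) (at z) \<and> 0 \<le> d"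
        by (intro exI[of _ "d + 2 * (1 + \<alpha>)"] conjI DERIV_add) auto
    next
      show "continuous_on {x..y} ?f'"
        by (intro continuous_intros continuous_on_compose2[OF continuous_on_stiffness[OF \<alpha> b]]) auto
    qed
  qed fact+
  then show ?thesis by (simp add: power2_eq_square algebra_simps)
qed

text \<open>Concavity of \<open>elastic_density\<close> gives the upper bound; the lower bound is convexity of
  \<open>t \<mapsto> elastic_density (t\<^sup>2) + (1 + \<alpha>) t\<^sup>2\<close>, combined with \<open>\<bar>\<bar>T + h\<bar> - \<bar>T\<bar>\<bar> \<le> \<bar>h\<bar>\<close>.\<close>

lemma elastic_density_norm_remainder:
  fixes T h :: "'a::real_inner"
  assumes \<alpha>: "\<alpha> > 0" and b: "b \<ge> 0"
  shows "\<bar>elastic_density \<alpha> b ((norm (T + h))\<^sup>2) - elastic_density \<alpha> b ((norm T)\<^sup>2) - stiffness \<alpha> b ((norm T)\<^sup>2) * (T \<bullet> h)\<bar>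
    \<le> (1 + \<alpha>) * (norm h)\<^sup>2"
proof -
  define k where "k = stiffness \<alpha> b ((norm T)\<^sup>2)"
  have k: "0 \<le> k" "k \<le> 1"
    using stiffness_nonneg stiffness_le_1[OF \<alpha> b] by (auto simp: k_def)
  have sq: "(norm (T + h))\<^sup>2 - (norm T)\<^sup>2 = 2 * (T \<bullet> h) + (norm h)\<^sup>2"
    by (simp add: power2_norm_eq_inner inner_add_left inner_add_right inner_commute)
  have "elastic_density \<alpha> b ((norm (T + h))\<^sup>2) - elastic_density \<alpha> b ((norm T)\<^sup>2) \<le> k / 2 * (2 * (T \<bullet> h) + (norm h)\<^sup>2)"
    unfolding sq[symmetric] k_def by (intro elastic_density_diff_le \<alpha> b) auto
  also have "\<dots> = k * (T \<bullet> h) + k / 2 * (norm h)\<^sup>2"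
    by (simp add: algebra_simps)
  also have "k / 2 * (norm h)\<^sup>2 \<le> (1 + \<alpha>) * (norm h)\<^sup>2"
    using k \<alpha> by (intro mult_right_mono) auto
  finally have upper: "elastic_density \<alpha> b ((norm (T + h))\<^sup>2) - elastic_density \<alpha> b ((norm T)\<^sup>2) - k * (T \<bullet> h)
      \<le> (1 + \<alpha>) * (norm h)\<^sup>2"
    by simp
  \<comment> \<open>Cauchy-Schwarz for \<open>T\<close> and \<open>T + h\<close> compares the radial
    increment with the inner product.\<close>
  have "norm T * (norm (T + h) - norm T) \<ge> T \<bullet> h"
    using norm_cauchy_schwarz[of T "T + h"]
    by (simp add: inner_add_right right_diff_distrib power2_norm_eq_inner[symmetric] power2_eq_square)
  then have "k * (T \<bullet> h) \<le> k * (norm T * (norm (T + h) - norm T))"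
    using k by (intro mult_left_mono)
  moreover have "(1 + \<alpha>) * (norm (T + h) - norm T)\<^sup>2 \<le> (1 + \<alpha>) * (norm h)\<^sup>2"
    using norm_triangle_ineq3[of "T + h" T] \<alpha>
    by (intro mult_left_mono) (auto simp: power2_le_iff_abs_le)
  moreover have "elastic_density \<alpha> b ((norm (T + h))\<^sup>2) - elastic_density \<alpha> b ((norm T)\<^sup>2) \<ge>
      k * norm T * (norm (T + h) - norm T) - (1 + \<alpha>) * (norm (T + h) - norm T)\<^sup>2"
    unfolding k_def by (intro elastic_density_square_diff_ge \<alpha> b) auto
  ultimately show ?thesis
    using upper unfolding k_def[symmetric] by (simp add: abs_le_iff mult.assoc)
qed

section \<open>The degradation factor and its linearisation\<close>

lemma degradation_square: "0 < \<kappa> \<Longrightarrow> \<kappa> < 1 \<Longrightarrow> (degradation \<kappa> v)\<^sup>2 = (1 - \<kappa>) * v\<^sup>2 + \<kappa>"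
  by (simp add: degradation_def)

lemma degradation_ge: "\<kappa> < 1 \<Longrightarrow> sqrt \<kappa> \<le> degradation \<kappa> v"
  by (simp add: degradation_def)

lemma degradation_le:
  assumes "0 < \<kappa>" "\<kappa> < 1"
  shows "degradation \<kappa> v \<le> 1 + \<bar>v\<bar>"
proof -
  have "(1 - \<kappa>) * v\<^sup>2 + \<kappa> \<le> 1 * v\<^sup>2 + 1"
    using assms by (intro add_mono mult_right_mono) auto
  also have "\<dots> \<le> (1 + \<bar>v\<bar>)\<^sup>2" by (simp add: power2_sum)
  finally show ?thesis unfolding degradation_def by (intro real_le_lsqrt) auto
qed

text \<open>As \<open>1 - \<kappa> \<le> 1\<close>, the square of \<open>(1 - \<kappa>) * v\<close>
  is at most \<open>(1 - \<kappa>) * v\<^sup>2\<close>, hence at most the square of the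
  denominator.\<close>

lemma degradation_slope_le:
  assumes "0 < \<kappa>" "\<kappa> < 1"
  shows "\<bar>(1 - \<kappa>) * v / degradation \<kappa> v\<bar> \<le> 1"
proof -
  have pos: "degradation \<kappa> v > 0" using degradation_ge[of \<kappa> v] assms by (smt (verit) real_sqrt_gt_zero)
  have "(1 - \<kappa>) * ((1 - \<kappa>) * v\<^sup>2) \<le> 1 * ((1 - \<kappa>) * v\<^sup>2)"
    using assms by (intro mult_right_mono) auto
  then have "((1 - \<kappa>) * v)\<^sup>2 \<le> (1 - \<kappa>) * v\<^sup>2"
    by (simp add: power2_eq_square mult_ac)
  then have "((1 - \<kappa>) * v)\<^sup>2 \<le> (degradation \<kappa> v)\<^sup>2"
    using assms by (simp add: degradation_square)
  then have "\<bar>(1 - \<kappa>) * v\<bar> \<le> degradation \<kappa> v"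
    using pos by (simp add: abs_le_square_iff[symmetric])
  then show ?thesis using pos by (simp add: abs_divide)
qed

text \<open>\<open>degradation \<kappa> x\<close> is the Euclidean norm of the plane vector with
  entries \<open>sqrt (1 - \<kappa>) * x\<close> and \<open>sqrt \<kappa>\<close>, so this is the
  reverse triangle inequality. The Cauchy-Schwarz step behind it comes from Lagrange's
  identity.\<close>

lemma degradation_diff_square_le:
  assumes "0 < \<kappa>" "\<kappa> < 1"
  shows "(degradation \<kappa> y - degradation \<kappa> x)\<^sup>2 \<le> (1 - \<kappa>) * (y - x)\<^sup>2"
proof -
  let ?q = "1 - \<kappa>"
  have nn: "degradation \<kappa> x * degradation \<kappa> y \<ge> 0" using assms by (simp add: degradation_def)
  have "(degradation \<kappa> x * degradation \<kappa> y)\<^sup>2 = (?q * x\<^sup>2 + \<kappa>) * (?q * y\<^sup>2 + \<kappa>)"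
    using assms by (simp add: power_mult_distrib degradation_square)
  then have "(degradation \<kappa> x * degradation \<kappa> y)\<^sup>2 - (?q * x * y + \<kappa>)\<^sup>2 = ?q * \<kappa> * (x - y)\<^sup>2"
    by algebra
  moreover have "?q * \<kappa> * (x - y)\<^sup>2 \<ge> 0" using assms by simp
  ultimately have "(?q * x * y + \<kappa>)\<^sup>2 \<le> (degradation \<kappa> x * degradation \<kappa> y)\<^sup>2"
    by (metis diff_ge_0_iff_ge)
  from power2_le_imp_le[OF this nn] have "?q * x * y + \<kappa> \<le> degradation \<kappa> x * degradation \<kappa> y" .
  moreover have "(degradation \<kappa> y - degradation \<kappa> x)\<^sup>2 = ?q * y\<^sup>2 + ?q * x\<^sup>2 + 2 * \<kappa> - 2 * (degradation \<kappa> x * degradation \<kappa> y)"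
    using assms by (simp add: power2_diff degradation_square)
  ultimately show ?thesis by (simp add: power2_diff algebra_simps)
qed

lemma degradation_lipschitz:
  assumes "0 < \<kappa>" "\<kappa> < 1"
  shows "\<bar>degradation \<kappa> y - degradation \<kappa> x\<bar> \<le> \<bar>y - x\<bar>"
proof -
  have "(1 - \<kappa>) * (y - x)\<^sup>2 \<le> 1 * (y - x)\<^sup>2"
    using assms by (intro mult_right_mono) auto
  then show ?thesis
    using degradation_diff_square_le[OF assms, of y x] by (simp add: abs_le_square_iff)
qed

text \<open>Multiplied by \<open>2 * degradation \<kappa> x\<close>, the remainder equals
  \<open>?r\<close> exactly, a difference of squares lying between 0 and
  \<open>(y - x)\<^sup>2\<close>. The denominator is at least \<open>2 * sqrt \<kappa>\<close>,
  which is where \<open>\<kappa> > 0\<close> pays off.\<close>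

lemma degradation_remainder:
  assumes \<kappa>: "0 < \<kappa>" "\<kappa> < 1"
  shows "\<bar>degradation \<kappa> y - degradation \<kappa> x - (1 - \<kappa>) * x / degradation \<kappa> x * (y - x)\<bar> \<le> (y - x)\<^sup>2 / (2 * sqrt \<kappa>)"
proof -
  have s: "sqrt \<kappa> > 0" using \<kappa> by simp
  have pos: "degradation \<kappa> x > 0" using degradation_ge[of \<kappa> x] \<kappa> s by linarith
  let ?r = "(1 - \<kappa>) * (y - x)\<^sup>2 - (degradation \<kappa> y - degradation \<kappa> x)\<^sup>2"
  have "?r = 2 * degradation \<kappa> x * (degradation \<kappa> y - degradation \<kappa> x) - 2 * ((1 - \<kappa>) * x * (y - x))"
  proof -
    have "(1 - \<kappa>) * (y - x)\<^sup>2 = ((1 - \<kappa>) * y\<^sup>2 + \<kappa>) - ((1 - \<kappa>) * x\<^sup>2 + \<kappa>) - 2 * ((1 - \<kappa>) * x * (y - x))"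
      by (simp add: power2_eq_square algebra_simps)
    also have "\<dots> = (degradation \<kappa> y)\<^sup>2 - (degradation \<kappa> x)\<^sup>2 - 2 * ((1 - \<kappa>) * x * (y - x))"
      using \<kappa> by (simp add: degradation_square)
    finally show ?thesis by (simp add: power2_eq_square algebra_simps)
  qed
  moreover have "degradation \<kappa> y - degradation \<kappa> x - (1 - \<kappa>) * x / degradation \<kappa> x * (y - x) =
      (2 * degradation \<kappa> x * (degradation \<kappa> y - degradation \<kappa> x) - 2 * ((1 - \<kappa>) * x * (y - x))) / (2 * degradation \<kappa> x)"
    using pos by (simp add: diff_divide_distrib)
  ultimately have "degradation \<kappa> y - degradation \<kappa> x - (1 - \<kappa>) * x / degradation \<kappa> x * (y - x) = ?r / (2 * degradation \<kappa> x)"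
    by simp
  moreover have "0 \<le> ?r / (2 * degradation \<kappa> x)"
    using degradation_diff_square_le[OF \<kappa>, of y x] pos by simp
  moreover have "?r / (2 * degradation \<kappa> x) \<le> (y - x)\<^sup>2 / (2 * sqrt \<kappa>)"
  proof (rule frac_le)
    have "(1 - \<kappa>) * (y - x)\<^sup>2 \<le> 1 * (y - x)\<^sup>2"
      using \<kappa> by (intro mult_right_mono) auto
    then show "?r \<le> (y - x)\<^sup>2"
      using zero_le_power2[of "degradation \<kappa> y - degradation \<kappa> x"] by linarith
  qed (use s degradation_ge[of \<kappa> x] \<kappa> in auto)
  ultimately show ?thesis by simp
qed

text \<open>Pointwise first variation, with \<open>G\<close> and \<open>P\<close> for the gradients
  of \<open>u\<close> and of its increment: the stress at
  \<open>T = degradation \<kappa> v *\<^sub>R G\<close>, paired with the linearised increment of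
  \<open>T\<close> given by the product rule.\<close>

definition elastic_variation :: "real \<Rightarrow> real \<Rightarrow> real \<Rightarrow> 'a::real_inner \<Rightarrow> real \<Rightarrow> 'a \<Rightarrow> real \<Rightarrow> real" where
  "elastic_variation \<alpha> b \<kappa> G v P \<phi> =
     stiffness \<alpha> b ((norm (degradation \<kappa> v *\<^sub>R G))\<^sup>2) *
       ((degradation \<kappa> v *\<^sub>R G) \<bullet> (((1 - \<kappa>) * v / degradation \<kappa> v * \<phi>) *\<^sub>R G + degradation \<kappa> v *\<^sub>R P))"

lemma elastic_variation_lincomb:
  "elastic_variation \<alpha> b \<kappa> G v (s *\<^sub>R P + t *\<^sub>R Q) (s * \<phi> + t * \<psi>) =
     s * elastic_variation \<alpha> b \<kappa> G v P \<phi> + t * elastic_variation \<alpha> b \<kappa> G v Q \<psi>"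
proof -
  have "(c * (s * \<phi> + t * \<psi>)) *\<^sub>R G + a *\<^sub>R (s *\<^sub>R P + t *\<^sub>R Q) =
      s *\<^sub>R ((c * \<phi>) *\<^sub>R G + a *\<^sub>R P) + t *\<^sub>R ((c * \<psi>) *\<^sub>R G + a *\<^sub>R Q)" for a c
    by (simp add: algebra_simps)
  then show ?thesis
    unfolding elastic_variation_def by (simp only: inner_add_right inner_scaleR_right) (simp only: distrib_left mult_ac)
qed

lemma stiffness_inner_le:
  fixes T h :: "'a::real_inner"
  assumes "\<alpha> > 0" "b \<ge> 0"
  shows "\<bar>stiffness \<alpha> b ((norm T)\<^sup>2) * (T \<bullet> h)\<bar> \<le> norm T * norm h"
proof -
  have "\<bar>stiffness \<alpha> b ((norm T)\<^sup>2)\<bar> \<le> 1"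
    using stiffness_le_1[OF assms, of "(norm T)\<^sup>2"] stiffness_nonneg[of \<alpha> b "(norm T)\<^sup>2"] by simp
  then have "\<bar>stiffness \<alpha> b ((norm T)\<^sup>2)\<bar> * \<bar>T \<bullet> h\<bar> \<le> 1 * (norm T * norm h)"
    by (intro mult_mono Cauchy_Schwarz_ineq2) auto
  then show ?thesis by (simp add: abs_mult)
qed

text \<open>The stiffness and the slope of \<open>degradation\<close> are at most 1 in absolute
  value. The bound \<open>m + 2\<close> for the degradation factor is the one that also serves at
  \<open>v + \<phi>\<close> when \<open>\<phi>\<close> is at most 1 in absolute value.\<close>

lemma elastic_variation_bound:
  fixes G P :: "'a::real_inner"
  assumes "\<alpha> > 0" "b \<ge> 0" and \<kappa>: "0 < \<kappa>" "\<kappa> < 1"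
    and "\<bar>v\<bar> \<le> m" "\<bar>\<phi>\<bar> \<le> n"
  shows "\<bar>elastic_variation \<alpha> b \<kappa> G v P \<phi>\<bar> \<le> (m + 2) * n * (norm G)\<^sup>2 + (m + 2)\<^sup>2 * (norm G * norm P)"
proof -
  have a: "0 \<le> degradation \<kappa> v" "degradation \<kappa> v \<le> m + 2"
    using degradation_le[OF \<kappa>, of v] \<kappa> assms by (auto simp: degradation_def)
  then have T: "norm (degradation \<kappa> v *\<^sub>R G) \<le> (m + 2) * norm G"
    by (simp add: mult_right_mono)
  have "\<bar>(1 - \<kappa>) * v / degradation \<kappa> v * \<phi>\<bar> \<le> 1 * n"
    unfolding abs_mult[of _ \<phi>] using degradation_slope_le[OF \<kappa>] assms by (intro mult_mono) auto
  then have "norm (((1 - \<kappa>) * v / degradation \<kappa> v * \<phi>) *\<^sub>R G + degradation \<kappa> v *\<^sub>R P) \<le> n * norm G + (m + 2) * norm P"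
    using a by (intro norm_triangle_mono) (auto intro!: mult_right_mono simp del: times_divide_eq_left)
  with T have "norm (degradation \<kappa> v *\<^sub>R G) * norm (((1 - \<kappa>) * v / degradation \<kappa> v * \<phi>) *\<^sub>R G + degradation \<kappa> v *\<^sub>R P)
      \<le> ((m + 2) * norm G) * (n * norm G + (m + 2) * norm P)"
    using assms by (intro mult_mono) auto
  also have "\<dots> = (m + 2) * n * (norm G)\<^sup>2 + (m + 2)\<^sup>2 * (norm G * norm P)"
    by (simp add: power2_eq_square algebra_simps)
  finally show ?thesis
    unfolding elastic_variation_def using stiffness_inner_le[OF assms(1,2)] order_trans by blast
qed

text \<open>The exact increment of \<open>T\<close> is \<open>h\<close>, and \<open>r\<close> is
  what \<open>h\<close> exceeds its linear part by. The remainder of the density in \<open>h\<close>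
  gives the first summand of \<open>K\<close>; the stress paired with \<open>r\<close> gives the
  other two, one from the remainder of \<open>degradation\<close> and one from the mixed term.
  \<open>n \<le> 1\<close> keeps \<open>a'\<close> below \<open>A\<close>.\<close>

lemma elastic_density_remainder:
  fixes G P :: "'a::real_inner"
  assumes \<alpha>: "\<alpha> > 0" and b: "b \<ge> 0" and \<kappa>: "0 < \<kappa>" "\<kappa> < 1"
    and v: "\<bar>v\<bar> \<le> m" and \<phi>: "\<bar>\<phi>\<bar> \<le> n" and n: "n \<le> 1"
    and K: "K = 2 * (1 + \<alpha>) * (m + 2)\<^sup>2 + (m + 2) / (2 * sqrt \<kappa>) + (m + 2) / 2"
  shows "\<bar>elastic_density \<alpha> b ((norm (degradation \<kappa> (v + \<phi>) *\<^sub>R (G + P)))\<^sup>2) - elastic_density \<alpha> b ((norm (degradation \<kappa> v *\<^sub>R G))\<^sup>2)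
      - elastic_variation \<alpha> b \<kappa> G v P \<phi>\<bar> \<le> K * (n\<^sup>2 * (norm G)\<^sup>2 + (norm P)\<^sup>2)"
proof -
  define A where "A = m + 2"
  define a a' c where "a = degradation \<kappa> v" and "a' = degradation \<kappa> (v + \<phi>)" and "c = (1 - \<kappa>) * v / degradation \<kappa> v"
  define g p where "g = norm G" and "p = norm P"
  have gp: "0 \<le> g" "0 \<le> p" by (auto simp: g_def p_def)
  have A: "2 \<le> A" using v by (auto simp: A_def)
  have n0: "0 \<le> n" using \<phi> by linarith
  have a: "0 \<le> a" "a \<le> A" "0 \<le> a'" "a' \<le> A"
    using degradation_le[OF \<kappa>, of v] degradation_le[OF \<kappa>, of "v + \<phi>"] \<kappa> v \<phi> n
    by (auto simp: a_def a'_def A_def degradation_def)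
  have da: "\<bar>a' - a\<bar> \<le> n"
    using degradation_lipschitz[OF \<kappa>, of "v + \<phi>" v] \<phi> by (simp add: a_def a'_def)
  have ra: "\<bar>a' - a - c * \<phi>\<bar> \<le> n\<^sup>2 / (2 * sqrt \<kappa>)"
  proof -
    have "\<bar>a' - a - c * \<phi>\<bar> \<le> \<phi>\<^sup>2 / (2 * sqrt \<kappa>)"
      using degradation_remainder[OF \<kappa>, of "v + \<phi>" v] by (simp add: a_def a'_def c_def)
    also have "\<dots> \<le> n\<^sup>2 / (2 * sqrt \<kappa>)"
      using \<phi> \<kappa> n0 by (intro divide_right_mono) (auto simp: abs_le_square_iff[symmetric])
    finally show ?thesis .
  qed
  define h where "h = (a' - a) *\<^sub>R G + a' *\<^sub>R P"
  define r where "r = (a' - a - c * \<phi>) *\<^sub>R G + (a' - a) *\<^sub>R P"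
  have h: "norm h \<le> n * g + A * p"
    unfolding h_def g_def p_def using a da
    by (intro norm_triangle_mono) (auto intro!: mult_right_mono)
  have r: "norm r \<le> n\<^sup>2 / (2 * sqrt \<kappa>) * g + n * p"
    unfolding r_def g_def p_def using ra da
    by (intro norm_triangle_mono) (auto intro!: mult_right_mono simp del: times_divide_eq_left)
  \<comment> \<open>Young's inequality absorbs the mixed term into the two squares.\<close>
  have np: "2 * (n * g * p) \<le> n\<^sup>2 * g\<^sup>2 + p\<^sup>2"
    using sum_squares_bound[of "n * g" p] by (simp add: power_mult_distrib mult.assoc)
  have "(norm h)\<^sup>2 \<le> (n * g + A * p)\<^sup>2"
    using h by (intro power_mono) auto
  also have "\<dots> \<le> 2 * (n * g)\<^sup>2 + 2 * (A * p)\<^sup>2"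
    using sum_squares_bound[of "n * g" "A * p"] by (simp add: power2_sum)
  also have "\<dots> \<le> 2 * A\<^sup>2 * (n\<^sup>2 * g\<^sup>2 + p\<^sup>2)"
  proof -
    have "1 * (n * g)\<^sup>2 \<le> A\<^sup>2 * (n * g)\<^sup>2"
      using A by (intro mult_right_mono) (auto simp: one_le_power)
    then show ?thesis by (simp add: power_mult_distrib algebra_simps)
  qed
  finally have h2: "(1 + \<alpha>) * (norm h)\<^sup>2 \<le> (1 + \<alpha>) * (2 * A\<^sup>2 * (n\<^sup>2 * g\<^sup>2 + p\<^sup>2))"
    using \<alpha> by (intro mult_left_mono) auto
  have rem: "\<bar>elastic_density \<alpha> b ((norm (a *\<^sub>R G + h))\<^sup>2) - elastic_density \<alpha> b ((norm (a *\<^sub>R G))\<^sup>2)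
      - stiffness \<alpha> b ((norm (a *\<^sub>R G))\<^sup>2) * ((a *\<^sub>R G) \<bullet> h)\<bar> \<le> (1 + \<alpha>) * (norm h)\<^sup>2"
    by (rule elastic_density_norm_remainder[OF \<alpha> b])
  have "\<bar>stiffness \<alpha> b ((norm (a *\<^sub>R G))\<^sup>2) * ((a *\<^sub>R G) \<bullet> r)\<bar> \<le> norm (a *\<^sub>R G) * norm r"
    by (rule stiffness_inner_le[OF \<alpha> b])
  also have "\<dots> \<le> (A * g) * (n\<^sup>2 / (2 * sqrt \<kappa>) * g + n * p)"
    using a A r by (intro mult_mono) (auto simp: g_def mult_right_mono)
  also have "\<dots> = A / (2 * sqrt \<kappa>) * (n\<^sup>2 * g\<^sup>2) + A / 2 * (2 * (n * g * p))"
    by (simp add: power2_eq_square algebra_simps)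
  also have "\<dots> \<le> A / (2 * sqrt \<kappa>) * (n\<^sup>2 * g\<^sup>2 + p\<^sup>2) + A / 2 * (n\<^sup>2 * g\<^sup>2 + p\<^sup>2)"
    using A \<kappa> np by (intro add_mono mult_left_mono) auto
  finally have r2: "\<bar>stiffness \<alpha> b ((norm (a *\<^sub>R G))\<^sup>2) * ((a *\<^sub>R G) \<bullet> r)\<bar> \<le>
      A / (2 * sqrt \<kappa>) * (n\<^sup>2 * g\<^sup>2 + p\<^sup>2) + A / 2 * (n\<^sup>2 * g\<^sup>2 + p\<^sup>2)" .
  have 1: "a' *\<^sub>R (G + P) = a *\<^sub>R G + h"
    by (simp add: h_def algebra_simps)
  have 2: "elastic_variation \<alpha> b \<kappa> G v P \<phi> =
      stiffness \<alpha> b ((norm (a *\<^sub>R G))\<^sup>2) * ((a *\<^sub>R G) \<bullet> h) - stiffness \<alpha> b ((norm (a *\<^sub>R G))\<^sup>2) * ((a *\<^sub>R G) \<bullet> r)"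
  proof -
    have "(c * \<phi>) *\<^sub>R G + a *\<^sub>R P = h - r"
      by (simp add: h_def r_def algebra_simps)
    then show ?thesis
      unfolding elastic_variation_def c_def[symmetric] unfolding a_def[symmetric]
      by (simp only: inner_diff_right right_diff_distrib)
  qed
  have "K * S = (1 + \<alpha>) * (2 * A\<^sup>2 * S) + (A / (2 * sqrt \<kappa>) * S + A / 2 * S)" for S
    unfolding K A_def[symmetric] by (simp add: algebra_simps)
  from this[of "n\<^sup>2 * g\<^sup>2 + p\<^sup>2"]
  have "K * (n\<^sup>2 * g\<^sup>2 + p\<^sup>2) = (1 + \<alpha>) * (2 * A\<^sup>2 * (n\<^sup>2 * g\<^sup>2 + p\<^sup>2)) +
      (A / (2 * sqrt \<kappa>) * (n\<^sup>2 * g\<^sup>2 + p\<^sup>2) + A / 2 * (n\<^sup>2 * g\<^sup>2 + p\<^sup>2))" .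
  with rem r2 h2 show ?thesis
    unfolding 1 2 a_def[symmetric] a'_def[symmetric] g_def[symmetric] p_def[symmetric] by linarith
qed

section \<open>The derivative of the energy\<close>

text \<open>Transferred from the inequality for nonnegative integrals, which coincide with the
  Bochner integrals because the squares and the product are integrable.\<close>

lemma L2_Cauchy_Schwarz:
  assumes f: "f \<in> L2 D" and g: "g \<in> L2 D"
  shows "(LINT x|lebesgue_on D. norm (f x) * norm (g x)) \<le>
    sqrt (LINT x|lebesgue_on D. (norm (f x))\<^sup>2) * sqrt (LINT x|lebesgue_on D. (norm (g x))\<^sup>2)"
proof -
  note [measurable] = L2_measurable[OF f] L2_measurable[OF g]
  have norm_L2: "(\<lambda>x. norm (f x)) \<in> L2 D" "(\<lambda>x. norm (g x)) \<in> L2 D"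
    using f g by (auto simp: L2_def)
  have fg: "integrable (lebesgue_on D) (\<lambda>x. norm (f x) * norm (g x))"
    using L2_inner_integrable[OF norm_L2] by simp
  let ?c = "LINT x|lebesgue_on D. norm (f x) * norm (g x)"
  let ?a = "LINT x|lebesgue_on D. (norm (f x))\<^sup>2"
  let ?b = "LINT x|lebesgue_on D. (norm (g x))\<^sup>2"
  have nn: "0 \<le> ?c" "0 \<le> ?a" "0 \<le> ?b" by (auto intro!: integral_nonneg_AE)
  have "(\<integral>\<^sup>+x. ennreal (norm (f x)) * ennreal (norm (g x)) \<partial>lebesgue_on D)\<^sup>2 \<le>
      (\<integral>\<^sup>+x. ennreal (norm (f x)) ^ 2 \<partial>lebesgue_on D) * (\<integral>\<^sup>+x. ennreal (norm (g x)) ^ 2 \<partial>lebesgue_on D)"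
    by (rule Cauchy_Schwarz_nn_integral) measurable
  then have "(ennreal ?c)\<^sup>2 \<le> ennreal ?a * ennreal ?b"
    using L2_square_integrable[OF f] L2_square_integrable[OF g] fg
    by (simp add: ennreal_mult'[symmetric] ennreal_power nn_integral_eq_integral)
  then have "?c\<^sup>2 \<le> ?a * ?b"
    using nn by (simp add: ennreal_mult'[symmetric] ennreal_power)
  then show ?thesis
    unfolding real_sqrt_mult[symmetric] by (intro real_le_rsqrt)
qed

section \<open>Integrability of the energy density and of its first variation\<close>

lemma stiffness_measurable [measurable]: "stiffness \<alpha> b \<in> borel_measurable borel"
  unfolding stiffness_def by measurable

lemma elastic_density_measurable [measurable]: "elastic_density \<alpha> b \<in> borel_measurable borel"
  unfolding elastic_density_def by measurable

lemma degradation_measurable [measurable]: "degradation \<kappa> \<in> borel_measurable borel"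
  unfolding degradation_def by measurable

text \<open>Integrates \<open>elastic_variation_bound\<close>. The uniform bound on
  \<open>\<phi>\<close> controls its product with \<open>(norm (G x))\<^sup>2\<close>, which is
  merely integrable; this is why the increments carry an essential supremum norm.\<close>

lemma elastic_variation_integrable:
  assumes "\<alpha> > 0" "b \<ge> 0" "0 < \<kappa>" "\<kappa> < 1"
    and G: "G \<in> L2 D" and P: "P \<in> L2 D"
    and [measurable]: "v \<in> borel_measurable (lebesgue_on D)" "\<phi> \<in> borel_measurable (lebesgue_on D)"
    and v: "AE x in lebesgue_on D. \<bar>v x\<bar> \<le> m" and \<phi>: "AE x in lebesgue_on D. \<bar>\<phi> x\<bar> \<le> n"
  shows "integrable (lebesgue_on D) (\<lambda>x. elastic_variation \<alpha> b \<kappa> (G x) (v x) (P x) (\<phi> x))"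
    and "\<bar>LINT x|lebesgue_on D. elastic_variation \<alpha> b \<kappa> (G x) (v x) (P x) (\<phi> x)\<bar> \<le>
      (m + 2) * n * (LINT x|lebesgue_on D. (norm (G x))\<^sup>2) +
      (m + 2)\<^sup>2 * (sqrt (LINT x|lebesgue_on D. (norm (G x))\<^sup>2) * sqrt (LINT x|lebesgue_on D. (norm (P x))\<^sup>2))"
proof -
  note [measurable] = L2_measurable[OF G] L2_measurable[OF P]
  let ?f = "\<lambda>x. elastic_variation \<alpha> b \<kappa> (G x) (v x) (P x) (\<phi> x)"
  let ?B = "\<lambda>x. (m + 2) * n * (norm (G x))\<^sup>2 + (m + 2)\<^sup>2 * (norm (G x) * norm (P x))"
  have "(\<lambda>x. norm (G x)) \<in> L2 D" "(\<lambda>x. norm (P x)) \<in> L2 D"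
    using G P by (auto simp: L2_def)
  from L2_inner_integrable[OF this]
  have GP: "integrable (lebesgue_on D) (\<lambda>x. norm (G x) * norm (P x))" by simp
  have B: "integrable (lebesgue_on D) ?B"
    using GP L2_square_integrable[OF G] by simp
  have le: "AE x in lebesgue_on D. \<bar>?f x\<bar> \<le> ?B x"
    using v \<phi> by eventually_elim (rule elastic_variation_bound[OF assms(1-4)])
  show f: "integrable (lebesgue_on D) ?f"
  proof (rule Bochner_Integration.integrable_bound[OF B])
    show "AE x in lebesgue_on D. norm (?f x) \<le> norm (?B x)"
      using le by eventually_elim auto
  qed (unfold elastic_variation_def, measurable)
  have "\<bar>LINT x|lebesgue_on D. ?f x\<bar> \<le> (LINT x|lebesgue_on D. \<bar>?f x\<bar>)"
    by (rule integral_abs_bound)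
  also have "\<dots> \<le> (LINT x|lebesgue_on D. ?B x)"
    using le f B by (intro integral_mono_AE) auto
  also have "\<dots> = (m + 2) * n * (LINT x|lebesgue_on D. (norm (G x))\<^sup>2) +
      (m + 2)\<^sup>2 * (LINT x|lebesgue_on D. norm (G x) * norm (P x))"
    using GP L2_square_integrable[OF G] by simp
  also have "\<dots> \<le> (m + 2) * n * (LINT x|lebesgue_on D. (norm (G x))\<^sup>2) +
      (m + 2)\<^sup>2 * (sqrt (LINT x|lebesgue_on D. (norm (G x))\<^sup>2) * sqrt (LINT x|lebesgue_on D. (norm (P x))\<^sup>2))"
    by (intro add_left_mono mult_left_mono L2_Cauchy_Schwarz G P) auto
  finally show "\<bar>LINT x|lebesgue_on D. ?f x\<bar> \<le> \<dots>" .
qed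

definition energy_density ::
    "real \<Rightarrow> real \<Rightarrow> real \<Rightarrow> real \<Rightarrow> real \<Rightarrow> 'a::real_inner \<Rightarrow> 'a \<Rightarrow> real \<Rightarrow> real" where
  "energy_density \<alpha> b \<kappa> \<rho> \<delta> G H v =
     elastic_density \<alpha> b ((norm (degradation \<kappa> v *\<^sub>R G))\<^sup>2) + \<rho> * (norm H)\<^sup>2 + \<delta> * (1 - v)"

lemma energy_eq:
  "energy \<alpha> \<beta> \<kappa> \<rho> \<delta> D u v = (LINT x|lebesgue_on D.
     energy_density \<alpha> (\<beta> powr \<alpha>) \<kappa> \<rho> \<delta> (weak_grad D u x) (weak_grad D v x) (v x))"
proof -
  \<comment> \<open>At \<open>t = 0\<close> both sides are 0 because
    \<open>0 powr a = 0\<close>.\<close>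
  have "t powr (2 * \<alpha>) = t\<^sup>2 powr \<alpha>" if "0 \<le> t" for t :: real
    using that by (cases "t = 0") (simp_all add: powr_powr[symmetric])
  then show ?thesis
    unfolding energy_def energy_density_def elastic_density_def degradation_def Let_def by simp
qed

lemma energy_density_integrable:
  assumes D: "open D" "bounded D" and "\<alpha> > 0" "b \<ge> 0" and \<kappa>: "0 < \<kappa>" "\<kappa> < 1"
    and G: "G \<in> L2 D" and H: "H \<in> L2 D" and v: "v \<in> L2 D"
    and m: "AE x in lebesgue_on D. \<bar>v x\<bar> \<le> m"
  shows "integrable (lebesgue_on D) (\<lambda>x. energy_density \<alpha> b \<kappa> \<rho> \<delta> (G x) (H x) (v x))"
proof -
  note [measurable] = L2_measurable[OF G] L2_measurable[OF v]
  let ?f = "\<lambda>x. elastic_density \<alpha> b ((norm (degradation \<kappa> (v x) *\<^sub>R G x))\<^sup>2)"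
  have T: "(\<lambda>x. degradation \<kappa> (v x) *\<^sub>R G x) \<in> L2 D"
  proof (rule L2_bound[OF G])
    show "AE x in lebesgue_on D. norm (degradation \<kappa> (v x) *\<^sub>R G x) \<le> (1 + m) * norm (G x)"
      using m
    proof eventually_elim
      case (elim x)
      then have "\<bar>degradation \<kappa> (v x)\<bar> \<le> 1 + m"
        using degradation_le[OF \<kappa>, of "v x"] \<kappa> by (simp add: degradation_def)
      then show ?case by (simp add: mult_right_mono)
    qed
  qed measurable
  \<comment> \<open>The denominator is at least 1, so the density grows at most like the square of
    the norm of \<open>T\<close>.\<close>
  have "\<bar>elastic_density \<alpha> b s\<bar> \<le> s" if "0 \<le> s" for s
  proof -
    have "1 + b * s powr \<alpha> \<ge> 1" using assms by simp
    then have "(1 + b * s powr \<alpha>) powr (1 / \<alpha>) \<ge> 1"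
      using assms by (intro ge_one_powr_ge_zero) auto
    then have "s / (2 * (1 + b * s powr \<alpha>) powr (1 / \<alpha>)) \<le> s / 1"
      using that by (intro divide_left_mono) auto
    then show ?thesis using that by (simp add: elastic_density_def)
  qed
  then have "integrable (lebesgue_on D) ?f"
    by (intro Bochner_Integration.integrable_bound[OF L2_square_integrable[OF T]] AE_I2) auto
  moreover have "integrable (lebesgue_on D) (\<lambda>x. 1 - v x)"
    using L2_integrable[OF D v] L2_integrable[OF D L2_const[OF D, of "1::real"]] by simp
  ultimately show ?thesis
    unfolding energy_density_def using L2_square_integrable[OF H] by simp
qed

section \<open>The candidate derivative: linearity, boundedness, quadratic remainder\<close>

lemma weak_grad_square_integral_le:
  "(LINT x|lebesgue_on D. (norm (weak_grad D u x))\<^sup>2) \<le> (H1_norm D u)\<^sup>2"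
  by (simp add: H1_norm_def integral_nonneg_AE)

text \<open>Formal differentiation of the energy under the integral sign.\<close>

definition energy_derivative ::
    "real \<Rightarrow> real \<Rightarrow> real \<Rightarrow> real \<Rightarrow> real \<Rightarrow> (real^'n) set \<Rightarrow>
     (real^'n \<Rightarrow> real) \<Rightarrow> (real^'n \<Rightarrow> real) \<Rightarrow> (real^'n \<Rightarrow> real) \<Rightarrow> (real^'n \<Rightarrow> real) \<Rightarrow> real" where
  "energy_derivative \<alpha> b \<kappa> \<rho> \<delta> D u v \<psi> \<phi> =
     (LINT x|lebesgue_on D.
        elastic_variation \<alpha> b \<kappa> (weak_grad D u x) (v x) (weak_grad D \<psi> x) (\<phi> x)
        + 2 * \<rho> * (weak_grad D v x \<bullet> weak_grad D \<phi> x) - \<delta> * \<phi> x)"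

context
  fixes D :: "(real^'n) set" and \<alpha> b \<kappa> \<rho> \<delta> :: real
  assumes D: "open D" "bounded D"
    and \<alpha>: "\<alpha> > 0" and b: "b \<ge> 0" and \<kappa>: "0 < \<kappa>" "\<kappa> < 1" and \<rho>: "\<rho> > 0" and \<delta>: "\<delta> > 0"
begin

lemma energy_derivative_integrable:
  assumes u: "u \<in> H1 D" and v: "v \<in> H1 D \<inter> Linf D" and \<psi>: "\<psi> \<in> H1 D" and \<phi>: "\<phi> \<in> H1 D \<inter> Linf D"
  shows "integrable (lebesgue_on D)
      (\<lambda>x. elastic_variation \<alpha> b \<kappa> (weak_grad D u x) (v x) (weak_grad D \<psi> x) (\<phi> x))" (is ?I1)
    and "integrable (lebesgue_on D) (\<lambda>x. weak_grad D v x \<bullet> weak_grad D \<phi> x)" (is ?I2)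
    and "integrable (lebesgue_on D) \<phi>" (is ?I3)
    and "integrable (lebesgue_on D)
      (\<lambda>x. elastic_variation \<alpha> b \<kappa> (weak_grad D u x) (v x) (weak_grad D \<psi> x) (\<phi> x)
        + 2 * \<rho> * (weak_grad D v x \<bullet> weak_grad D \<phi> x) - \<delta> * \<phi> x)"
proof -
  show 1: ?I1
    using assms
    by (intro elastic_variation_integrable(1)[OF \<alpha> b \<kappa>, where m = "Linf_norm D v" and n = "Linf_norm D \<phi>"]
        weak_grad_works L2_measurable[OF H1_imp_L2] Linf_norm_works) auto
  show 2: ?I2
    using v \<phi> by (intro L2_inner_integrable weak_grad_works) auto
  show 3: ?I3
    using \<phi> by (intro L2_integrable[OF D] H1_imp_L2) auto
  show "integrable (lebesgue_on D)
      (\<lambda>x. elastic_variation \<alpha> b \<kappa> (weak_grad D u x) (v x) (weak_grad D \<psi> x) (\<phi> x)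
        + 2 * \<rho> * (weak_grad D v x \<bullet> weak_grad D \<phi> x) - \<delta> * \<phi> x)"
    using 1 2 3 by simp
qed

text \<open>The integrand is linear in gradients and values, and the weak gradients of the
  combinations are the combinations of the weak gradients almost everywhere.\<close>

lemma energy_derivative_lincomb:
  assumes u: "u \<in> H1 D" and v: "v \<in> H1 D \<inter> Linf D"
    and \<psi>: "\<psi> \<in> H1 D" "\<psi>' \<in> H1 D" and \<phi>: "\<phi> \<in> H1 D \<inter> Linf D" "\<phi>' \<in> H1 D \<inter> Linf D"
  shows "energy_derivative \<alpha> b \<kappa> \<rho> \<delta> D u v (\<lambda>x. s * \<psi> x + t * \<psi>' x) (\<lambda>x. s * \<phi> x + t * \<phi>' x) =
    s * energy_derivative \<alpha> b \<kappa> \<rho> \<delta> D u v \<psi> \<phi> + t * energy_derivative \<alpha> b \<kappa> \<rho> \<delta> D u v \<psi>' \<phi>'"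
proof -
  let ?E = "\<lambda>P Q \<phi> x. elastic_variation \<alpha> b \<kappa> (weak_grad D u x) (v x) (P x) (\<phi> x)
        + 2 * \<rho> * (weak_grad D v x \<bullet> Q x) - \<delta> * \<phi> x"
  let ?\<psi> = "\<lambda>x. s * \<psi> x + t * \<psi>' x" and ?\<phi> = "\<lambda>x. s * \<phi> x + t * \<phi>' x"
  have H1: "?\<psi> \<in> H1 D" "?\<phi> \<in> H1 D"
    using \<psi> \<phi> by (auto intro!: H1_lincomb D)
  note [measurable] = L2_measurable[OF weak_grad_works(1)[OF H1(1)]] L2_measurable[OF weak_grad_works(1)[OF H1(2)]]
    L2_measurable[OF weak_grad_works(1)[OF u]] L2_measurable[OF H1_imp_L2[OF H1(2)]]
  have [measurable]: "v \<in> borel_measurable (lebesgue_on D)" "weak_grad D v \<in> borel_measurable (lebesgue_on D)"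
    using v by (auto intro!: L2_measurable H1_imp_L2 weak_grad_works)
  note int = energy_derivative_integrable(4)[OF u v \<psi>(1) \<phi>(1)] energy_derivative_integrable(4)[OF u v \<psi>(2) \<phi>(2)]
  have "energy_derivative \<alpha> b \<kappa> \<rho> \<delta> D u v ?\<psi> ?\<phi> = (LINT x|lebesgue_on D.
      s * ?E (weak_grad D \<psi>) (weak_grad D \<phi>) \<phi> x + t * ?E (weak_grad D \<psi>') (weak_grad D \<phi>') \<phi>' x)"
    unfolding energy_derivative_def
  proof (rule integral_cong_AE)
    have "AE x in lebesgue_on D. weak_grad D ?\<psi> x = s *\<^sub>R weak_grad D \<psi> x + t *\<^sub>R weak_grad D \<psi>' x"
      "AE x in lebesgue_on D. weak_grad D ?\<phi> x = s *\<^sub>R weak_grad D \<phi> x + t *\<^sub>R weak_grad D \<phi>' x"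
      using \<psi> \<phi> by (auto intro!: weak_grad_lincomb D)
    then show "AE x in lebesgue_on D. ?E (weak_grad D ?\<psi>) (weak_grad D ?\<phi>) ?\<phi> x =
        s * ?E (weak_grad D \<psi>) (weak_grad D \<phi>) \<phi> x + t * ?E (weak_grad D \<psi>') (weak_grad D \<phi>') \<phi>' x"
    proof eventually_elim
      case (elim x)
      show ?case
        unfolding elim elastic_variation_lincomb by (simp add: inner_add_right algebra_simps)
    qed
    show "?E (weak_grad D ?\<psi>) (weak_grad D ?\<phi>) ?\<phi> \<in> borel_measurable (lebesgue_on D)"
      unfolding elastic_variation_def by measurable
  qed (use int in measurable)
  also have "\<dots> = s * (LINT x|lebesgue_on D. ?E (weak_grad D \<psi>) (weak_grad D \<phi>) \<phi> x) +
      t * (LINT x|lebesgue_on D. ?E (weak_grad D \<psi>') (weak_grad D \<phi>') \<phi>' x)"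
    using int by (subst Bochner_Integration.integral_add) auto
  finally show ?thesis
    unfolding energy_derivative_def .
qed

lemma energy_derivative_bounded:
  assumes u: "u \<in> H1 D" and v: "v \<in> H1 D \<inter> Linf D"
  shows "\<exists>C. \<forall>\<psi>\<in>H1 D. \<forall>\<phi>\<in>H1 D \<inter> Linf D. \<bar>energy_derivative \<alpha> b \<kappa> \<rho> \<delta> D u v \<psi> \<phi>\<bar> \<le>
      C * (H1_norm D \<psi> + H1_norm D \<phi> + Linf_norm D \<phi>)"
proof -
  define A where "A = Linf_norm D v + 2"
  define g where "g = (LINT x|lebesgue_on D. (norm (weak_grad D u x))\<^sup>2)"
  define w where "w = (LINT x|lebesgue_on D. (norm (weak_grad D v x))\<^sup>2)"
  define V where "V = (LINT x|lebesgue_on D. (1::real))"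
  have nn: "0 \<le> A" "0 \<le> g" "0 \<le> w" "0 \<le> V"
    using Linf_norm_nonneg[of D v] by (auto simp: A_def g_def w_def V_def intro!: integral_nonneg_AE)
  \<comment> \<open>The first two summands bound the elastic variation, the third comes from
    Cauchy-Schwarz for the gradients of \<open>v\<close> and \<open>\<phi>\<close>, and the last
    from |\<phi>| being at most its essential supremum on a set of measure \<open>V\<close>.\<close>
  define C where "C = A * g + A\<^sup>2 * sqrt g + 2 * \<rho> * sqrt w + \<delta> * V"
  show ?thesis
  proof (intro exI[of _ C] ballI)
    fix \<psi> \<phi> assume \<psi>: "\<psi> \<in> H1 D" and \<phi>: "\<phi> \<in> H1 D \<inter> Linf D"
    let ?n = "Linf_norm D \<phi>" and ?N = "H1_norm D \<psi> + H1_norm D \<phi> + Linf_norm D \<phi>"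
    note N = H1_norm_nonneg[of D \<psi>] H1_norm_nonneg[of D \<phi>] Linf_norm_nonneg[of D \<phi>]
    note int = energy_derivative_integrable[OF u v \<psi> \<phi>]
    let ?I1 = "LINT x|lebesgue_on D. elastic_variation \<alpha> b \<kappa> (weak_grad D u x) (v x) (weak_grad D \<psi> x) (\<phi> x)"
    let ?I2 = "LINT x|lebesgue_on D. weak_grad D v x \<bullet> weak_grad D \<phi> x"
    let ?I3 = "LINT x|lebesgue_on D. \<phi> x"
    have "energy_derivative \<alpha> b \<kappa> \<rho> \<delta> D u v \<psi> \<phi> = ?I1 + 2 * \<rho> * ?I2 - \<delta> * ?I3"
      unfolding energy_derivative_def using int(1-3) by simp
    moreover have "\<bar>?I1\<bar> \<le> A * g * ?N + A\<^sup>2 * sqrt g * ?N"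
    proof -
      have "\<bar>?I1\<bar> \<le> A * ?n * g + A\<^sup>2 * (sqrt g * sqrt (LINT x|lebesgue_on D. (norm (weak_grad D \<psi> x))\<^sup>2))"
        unfolding A_def g_def using u v \<psi> \<phi>
        by (intro elastic_variation_integrable(2)[OF \<alpha> b \<kappa>] weak_grad_works
            L2_measurable[OF H1_imp_L2] Linf_norm_works) auto
      also have "\<dots> \<le> A * ?N * g + A\<^sup>2 * (sqrt g * ?N)"
        using nn N weak_grad_L2_norm_le[of D \<psi>]
        by (intro add_mono mult_left_mono mult_right_mono) auto
      finally show ?thesis by (simp add: mult_ac)
    qed
    moreover have "\<bar>2 * \<rho> * ?I2\<bar> \<le> 2 * \<rho> * sqrt w * ?N"
    proof -
      have L2: "weak_grad D v \<in> L2 D" "weak_grad D \<phi> \<in> L2 D"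
        using v \<phi> by (auto intro: weak_grad_works)
      then have "(\<lambda>x. norm (weak_grad D v x)) \<in> L2 D" "(\<lambda>x. norm (weak_grad D \<phi> x)) \<in> L2 D"
        by (auto simp: L2_def)
      from L2_inner_integrable[OF this] int(2)
      have "(LINT x|lebesgue_on D. \<bar>weak_grad D v x \<bullet> weak_grad D \<phi> x\<bar>) \<le>
          (LINT x|lebesgue_on D. norm (weak_grad D v x) * norm (weak_grad D \<phi> x))"
        by (intro integral_mono_AE AE_I2 Cauchy_Schwarz_ineq2) auto
      also have "\<dots> \<le> sqrt w * sqrt (LINT x|lebesgue_on D. (norm (weak_grad D \<phi> x))\<^sup>2)"
        unfolding w_def by (rule L2_Cauchy_Schwarz[OF L2])
      also have "\<dots> \<le> sqrt w * ?N"
        using nn N weak_grad_L2_norm_le[of D \<phi>] by (intro mult_left_mono) auto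
      finally have "\<bar>?I2\<bar> \<le> sqrt w * ?N"
        by (rule order_trans[OF integral_abs_bound])
      then have "2 * \<rho> * \<bar>?I2\<bar> \<le> 2 * \<rho> * (sqrt w * ?N)"
        using \<rho> by (intro mult_left_mono) auto
      then show ?thesis using \<rho> by (simp add: abs_mult mult.assoc)
    qed
    moreover have "\<bar>\<delta> * ?I3\<bar> \<le> \<delta> * V * ?N"
    proof -
      have "(LINT x|lebesgue_on D. \<bar>\<phi> x\<bar>) \<le> (LINT x|lebesgue_on D. ?n)"
        using int(3) L2_integrable[OF D L2_const[OF D, of ?n]] \<phi>
        by (intro integral_mono_AE Linf_norm_works) auto
      also have "\<dots> = ?n * V" by (simp add: V_def)
      also have "\<dots> \<le> ?N * V" using nn N by (intro mult_right_mono) auto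
      finally have "\<bar>?I3\<bar> \<le> ?N * V"
        by (rule order_trans[OF integral_abs_bound])
      then have "\<delta> * \<bar>?I3\<bar> \<le> \<delta> * (?N * V)"
        using \<delta> by (intro mult_left_mono) auto
      then show ?thesis using \<delta> by (simp add: abs_mult mult_ac)
    qed
    ultimately have "\<bar>energy_derivative \<alpha> b \<kappa> \<rho> \<delta> D u v \<psi> \<phi>\<bar> \<le>
        A * g * ?N + A\<^sup>2 * sqrt g * ?N + 2 * \<rho> * sqrt w * ?N + \<delta> * V * ?N"
      by linarith
    also have "\<dots> = C * ?N"
      unfolding C_def by (simp only: distrib_right)
    finally show "\<bar>energy_derivative \<alpha> b \<kappa> \<rho> \<delta> D u v \<psi> \<phi>\<bar> \<le> C * ?N" .
  qed
qed

text \<open>The square of the norm of \<open>H + Q\<close> expands exactly and leaves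
  \<open>\<rho> * (norm Q)\<^sup>2\<close>; the affine term in \<open>v\<close> leaves nothing. The
  rest is the elastic remainder.\<close>

lemma energy_density_remainder:
  fixes G P H Q :: "'a::real_inner"
  assumes v: "\<bar>v\<bar> \<le> m" and \<phi>: "\<bar>\<phi>\<bar> \<le> n" and n: "n \<le> 1"
    and K: "K = 2 * (1 + \<alpha>) * (m + 2)\<^sup>2 + (m + 2) / (2 * sqrt \<kappa>) + (m + 2) / 2"
  shows "\<bar>energy_density \<alpha> b \<kappa> \<rho> \<delta> (G + P) (H + Q) (v + \<phi>) - energy_density \<alpha> b \<kappa> \<rho> \<delta> G H v
      - (elastic_variation \<alpha> b \<kappa> G v P \<phi> + 2 * \<rho> * (H \<bullet> Q) - \<delta> * \<phi>)\<bar>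
    \<le> K * (n\<^sup>2 * (norm G)\<^sup>2 + (norm P)\<^sup>2) + \<rho> * (norm Q)\<^sup>2"
proof -
  have "energy_density \<alpha> b \<kappa> \<rho> \<delta> (G + P) (H + Q) (v + \<phi>) - energy_density \<alpha> b \<kappa> \<rho> \<delta> G H v
      - (elastic_variation \<alpha> b \<kappa> G v P \<phi> + 2 * \<rho> * (H \<bullet> Q) - \<delta> * \<phi>) =
      (elastic_density \<alpha> b ((norm (degradation \<kappa> (v + \<phi>) *\<^sub>R (G + P)))\<^sup>2) - elastic_density \<alpha> b ((norm (degradation \<kappa> v *\<^sub>R G))\<^sup>2)
      - elastic_variation \<alpha> b \<kappa> G v P \<phi>) + \<rho> * (norm Q)\<^sup>2"
    unfolding energy_density_def power2_norm_eq_inner[of "H + Q"] power2_norm_eq_inner[of H]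
      power2_norm_eq_inner[of Q]
    by (simp add: inner_add_left inner_add_right inner_commute[of Q H] algebra_simps)
  moreover have "0 \<le> \<rho> * (norm Q)\<^sup>2" using \<rho> by simp
  ultimately show ?thesis
    using elastic_density_remainder[OF \<alpha> b \<kappa> v \<phi> n K, of G P] by linarith
qed

text \<open>Integrates the pointwise remainder with the constant
  \<open>n = Linf_norm D \<phi>\<close>, which is at most 1 because the whole norm is. Integrability
  of all three densities allows the integrals to be combined into one.\<close>

lemma energy_remainder:
  assumes u: "u \<in> H1 D" and v: "v \<in> H1 D \<inter> Linf D"
  shows "\<exists>C\<ge>0. \<forall>\<psi>\<in>H1 D. \<forall>\<phi>\<in>H1 D \<inter> Linf D.
    H1_norm D \<psi> + H1_norm D \<phi> + Linf_norm D \<phi> \<le> 1 \<longrightarrow>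
    \<bar>(LINT x|lebesgue_on D. energy_density \<alpha> b \<kappa> \<rho> \<delta> (weak_grad D (\<lambda>x. u x + \<psi> x) x)
         (weak_grad D (\<lambda>x. v x + \<phi> x) x) (v x + \<phi> x))
     - (LINT x|lebesgue_on D. energy_density \<alpha> b \<kappa> \<rho> \<delta> (weak_grad D u x) (weak_grad D v x) (v x))
     - energy_derivative \<alpha> b \<kappa> \<rho> \<delta> D u v \<psi> \<phi>\<bar>
    \<le> C * (H1_norm D \<psi> + H1_norm D \<phi> + Linf_norm D \<phi>)\<^sup>2"
proof -
  define m where "m = Linf_norm D v"
  have m0: "0 \<le> m" unfolding m_def by (rule Linf_norm_nonneg)
  define K where "K = 2 * (1 + \<alpha>) * (m + 2)\<^sup>2 + (m + 2) / (2 * sqrt \<kappa>) + (m + 2) / 2"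
  have K0: "0 \<le> K" using m0 \<alpha> \<kappa> by (simp add: K_def)
  define g where "g = (LINT x|lebesgue_on D. (norm (weak_grad D u x))\<^sup>2)"
  have g0: "0 \<le> g" unfolding g_def by (simp add: integral_nonneg_AE)
  have Gu: "weak_grad D u \<in> L2 D" using u by (rule weak_grad_works)
  have Gv: "weak_grad D v \<in> L2 D" using v by (auto intro: weak_grad_works)
  have vL2: "v \<in> L2 D" using v by (auto intro: H1_imp_L2)
  have vm: "AE x in lebesgue_on D. \<bar>v x\<bar> \<le> m"
    unfolding m_def using v by (intro Linf_norm_works) auto
  show ?thesis
  \<comment> \<open>\<open>K * g\<close> collects the term with the gradient of \<open>u\<close>,
    \<open>K\<close> the one with the gradient of \<open>\<psi>\<close>, and \<open>\<rho>\<close>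
    the one with the gradient of \<open>\<phi>\<close>; each is multiplied by a square bounded by
    \<open>?N\<^sup>2\<close>.\<close>
  proof (intro exI[of _ "K * (g + 1) + \<rho>"] conjI ballI impI)
    show "0 \<le> K * (g + 1) + \<rho>" using K0 g0 \<rho> by simp
  next
    fix \<psi> \<phi> assume \<psi>: "\<psi> \<in> H1 D" and \<phi>: "\<phi> \<in> H1 D \<inter> Linf D"
    let ?n = "Linf_norm D \<phi>" and ?N = "H1_norm D \<psi> + H1_norm D \<phi> + Linf_norm D \<phi>"
    assume N1: "?N \<le> 1"
    note N = H1_norm_nonneg[of D \<psi>] H1_norm_nonneg[of D \<phi>] Linf_norm_nonneg[of D \<phi>]
    have P: "weak_grad D \<psi> \<in> L2 D" using \<psi> by (rule weak_grad_works)
    have Q: "weak_grad D \<phi> \<in> L2 D" using \<phi> by (auto intro: weak_grad_works)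
    have \<phi>n: "AE x in lebesgue_on D. \<bar>\<phi> x\<bar> \<le> ?n"
      using \<phi> by (intro Linf_norm_works) auto
    let ?u = "\<lambda>x. u x + \<psi> x" and ?v = "\<lambda>x. v x + \<phi> x"
    have H1: "?u \<in> H1 D" "?v \<in> H1 D"
      using H1_lincomb[OF D u \<psi>, of 1 1] H1_lincomb[OF D, of v \<phi> 1 1] v \<phi> by auto
    have grad: "AE x in lebesgue_on D. weak_grad D ?u x = weak_grad D u x + weak_grad D \<psi> x"
      "AE x in lebesgue_on D. weak_grad D ?v x = weak_grad D v x + weak_grad D \<phi> x"
      using weak_grad_lincomb[OF D u \<psi>, of 1 1] weak_grad_lincomb[OF D, of v \<phi> 1 1] v \<phi> by auto
    have v\<phi>: "AE x in lebesgue_on D. \<bar>v x + \<phi> x\<bar> \<le> m + ?n"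
      using vm \<phi>n by eventually_elim linarith
    let ?E1 = "\<lambda>x. energy_density \<alpha> b \<kappa> \<rho> \<delta> (weak_grad D ?u x) (weak_grad D ?v x) (v x + \<phi> x)"
    let ?E0 = "\<lambda>x. energy_density \<alpha> b \<kappa> \<rho> \<delta> (weak_grad D u x) (weak_grad D v x) (v x)"
    let ?L = "\<lambda>x. elastic_variation \<alpha> b \<kappa> (weak_grad D u x) (v x) (weak_grad D \<psi> x) (\<phi> x)
        + 2 * \<rho> * (weak_grad D v x \<bullet> weak_grad D \<phi> x) - \<delta> * \<phi> x"
    let ?B = "\<lambda>x. K * (?n\<^sup>2 * (norm (weak_grad D u x))\<^sup>2 + (norm (weak_grad D \<psi> x))\<^sup>2) +
        \<rho> * (norm (weak_grad D \<phi> x))\<^sup>2"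
    have E1: "integrable (lebesgue_on D) ?E1"
      using weak_grad_works(1) H1_imp_L2 H1
      by (intro energy_density_integrable[OF D \<alpha> b \<kappa> _ _ _ v\<phi>]) auto
    have E0: "integrable (lebesgue_on D) ?E0"
      by (rule energy_density_integrable[OF D \<alpha> b \<kappa> Gu Gv vL2 vm])
    have L: "integrable (lebesgue_on D) ?L"
      by (rule energy_derivative_integrable(4)[OF u v \<psi> \<phi>])
    have B: "integrable (lebesgue_on D) ?B"
      using L2_square_integrable[OF Gu] L2_square_integrable[OF P] L2_square_integrable[OF Q] by simp
    have "\<bar>integral\<^sup>L (lebesgue_on D) ?E1 - integral\<^sup>L (lebesgue_on D) ?E0 - energy_derivative \<alpha> b \<kappa> \<rho> \<delta> D u v \<psi> \<phi>\<bar>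
        = \<bar>LINT x|lebesgue_on D. ?E1 x - ?E0 x - ?L x\<bar>"
      unfolding energy_derivative_def
      by (simp only: Bochner_Integration.integral_diff[OF Bochner_Integration.integrable_diff[OF E1 E0] L]
          Bochner_Integration.integral_diff[OF E1 E0])
    also have "\<dots> \<le> (LINT x|lebesgue_on D. \<bar>?E1 x - ?E0 x - ?L x\<bar>)"
      by (rule integral_abs_bound)
    also have "\<dots> \<le> (LINT x|lebesgue_on D. ?B x)"
    proof (rule integral_mono_AE)
      show "AE x in lebesgue_on D. \<bar>?E1 x - ?E0 x - ?L x\<bar> \<le> ?B x"
        using grad vm \<phi>n
      proof eventually_elim
        case (elim x)
        show ?case
          unfolding elim(1,2)
          by (rule energy_density_remainder[OF elim(3,4) _ K_def]) (use N N1 in linarith)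
      qed
    qed (use E1 E0 L B in \<open>auto intro!: Bochner_Integration.integrable_diff integrable_abs
        simp del: Bochner_Integration.integrable_add\<close>)
    also have "\<dots> = K * (?n\<^sup>2 * g + (LINT x|lebesgue_on D. (norm (weak_grad D \<psi> x))\<^sup>2)) +
        \<rho> * (LINT x|lebesgue_on D. (norm (weak_grad D \<phi> x))\<^sup>2)"
      unfolding g_def
      using L2_square_integrable[OF Gu] L2_square_integrable[OF P] L2_square_integrable[OF Q] by simp
    also have "\<dots> \<le> K * (?N\<^sup>2 * g + ?N\<^sup>2) + \<rho> * ?N\<^sup>2"
    proof -
      have "(H1_norm D \<psi>)\<^sup>2 \<le> ?N\<^sup>2" "(H1_norm D \<phi>)\<^sup>2 \<le> ?N\<^sup>2" "?n\<^sup>2 \<le> ?N\<^sup>2"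
        using N by (auto intro!: power_mono)
      then show ?thesis
        using K0 g0 \<rho> weak_grad_square_integral_le[of D \<psi>] weak_grad_square_integral_le[of D \<phi>]
        by (intro add_mono mult_left_mono mult_right_mono) auto
    qed
    also have "\<dots> = (K * (g + 1) + \<rho>) * ?N\<^sup>2"
      by (simp add: algebra_simps)
    finally show "\<bar>integral\<^sup>L (lebesgue_on D) ?E1 - integral\<^sup>L (lebesgue_on D) ?E0
        - energy_derivative \<alpha> b \<kappa> \<rho> \<delta> D u v \<psi> \<phi>\<bar> \<le> (K * (g + 1) + \<rho>) * ?N\<^sup>2" .
  qed
qed

end

section \<open>Frechet differentiability from the quadratic remainder bound\<close>

theorem proposition2p2:
  fixes D :: "(real^'n) set" and \<alpha> \<beta> \<kappa> \<rho> \<delta> :: real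
  assumes "CARD('n) \<in> {2, 3}"
    and "smooth_bounded_domain D"
    and "\<alpha> > 0" and "\<beta> \<ge> 0" and "0 < \<kappa>" and "\<kappa> < 1" and "\<rho> > 0" and "\<delta> > 0"
  shows "\<forall>u\<in>H1 D. \<forall>v\<in>H1 D \<inter> Linf D.
    frechet_differentiable_at (H1 D) (H1 D \<inter> Linf D)
      (\<lambda>\<psi> \<phi>. H1_norm D \<psi> + H1_norm D \<phi> + Linf_norm D \<phi>)
      (energy \<alpha> \<beta> \<kappa> \<rho> \<delta> D) u v"
proof (intro ballI)
  fix u v assume u: "u \<in> H1 D" and v: "v \<in> H1 D \<inter> Linf D"
  have D: "open D" "bounded D"
    using assms(2) by (auto simp: smooth_bounded_domain_def)
  have b: "0 \<le> \<beta> powr \<alpha>" by simp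
  note params = D \<open>\<alpha> > 0\<close> b \<open>0 < \<kappa>\<close> \<open>\<kappa> < 1\<close> \<open>\<rho> > 0\<close> \<open>\<delta> > 0\<close>
  let ?L = "energy_derivative \<alpha> (\<beta> powr \<alpha>) \<kappa> \<rho> \<delta> D u v"
  let ?N = "\<lambda>\<psi> \<phi>. H1_norm D \<psi> + H1_norm D \<phi> + Linf_norm D \<phi>"
  let ?J = "energy \<alpha> \<beta> \<kappa> \<rho> \<delta> D"
  obtain C where C: "C \<ge> 0" and rem: "\<And>\<psi> \<phi>. \<psi> \<in> H1 D \<Longrightarrow> \<phi> \<in> H1 D \<inter> Linf D \<Longrightarrow> ?N \<psi> \<phi> \<le> 1 \<Longrightarrow>
      \<bar>?J (\<lambda>x. u x + \<psi> x) (\<lambda>x. v x + \<phi> x) - ?J u v - ?L \<psi> \<phi>\<bar> \<le> C * (?N \<psi> \<phi>)\<^sup>2"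
    using energy_remainder[OF params u v] unfolding energy_eq by blast
  have "\<exists>\<eta>>0. \<forall>\<psi>\<in>H1 D. \<forall>\<phi>\<in>H1 D \<inter> Linf D. ?N \<psi> \<phi> < \<eta> \<longrightarrow>
      \<bar>?J (\<lambda>x. u x + \<psi> x) (\<lambda>x. v x + \<phi> x) - ?J u v - ?L \<psi> \<phi>\<bar> \<le> \<epsilon> * ?N \<psi> \<phi>"
    if "\<epsilon> > 0" for \<epsilon>
  \<comment> \<open>The 1 makes the remainder bound applicable, and the quotient turns
    \<open>C\<close> times the squared norm into at most \<open>\<epsilon>\<close> times the norm;
    \<open>C + 1\<close> avoids division by zero.\<close>
  proof (intro exI[of _ "min 1 (\<epsilon> / (C + 1))"] conjI ballI impI)
    show "0 < min 1 (\<epsilon> / (C + 1))" using that C by simp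
    fix \<psi> \<phi> assume \<psi>: "\<psi> \<in> H1 D" and \<phi>: "\<phi> \<in> H1 D \<inter> Linf D" and lt: "?N \<psi> \<phi> < min 1 (\<epsilon> / (C + 1))"
    have N0: "0 \<le> ?N \<psi> \<phi>"
      by (intro add_nonneg_nonneg H1_norm_nonneg Linf_norm_nonneg)
    have "C * ?N \<psi> \<phi> \<le> (C + 1) * ?N \<psi> \<phi>"
      using N0 by (intro mult_right_mono) auto
    also have "\<dots> \<le> \<epsilon>"
      using lt C by (simp add: field_simps)
    finally have "C * ?N \<psi> \<phi> * ?N \<psi> \<phi> \<le> \<epsilon> * ?N \<psi> \<phi>"
      using N0 by (rule mult_right_mono)
    moreover have "\<bar>?J (\<lambda>x. u x + \<psi> x) (\<lambda>x. v x + \<phi> x) - ?J u v - ?L \<psi> \<phi>\<bar> \<le> C * (?N \<psi> \<phi>)\<^sup>2"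
      using lt by (intro rem \<psi> \<phi>) simp
    ultimately show "\<bar>?J (\<lambda>x. u x + \<psi> x) (\<lambda>x. v x + \<phi> x) - ?J u v - ?L \<psi> \<phi>\<bar> \<le> \<epsilon> * ?N \<psi> \<phi>"
      by (simp only: power2_eq_square mult.assoc)
  qed
  then show "frechet_differentiable_at (H1 D) (H1 D \<inter> Linf D) ?N ?J u v"
    unfolding frechet_differentiable_at_def
    using energy_derivative_lincomb[OF params u v] energy_derivative_bounded[OF params u v]
    by (intro exI[of _ ?L]) blast
qed

end
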